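(* Fix $n\geq 2$. Then: (i) The linear action of $G_n$ on $\mathbb{T}^n$ is ergodic and essentially free (with respect to the normalized Lebesgue measure). (ii) If $n$ is even and $h\in\operatorname{SL}_2(\mathbb{Z})$ is hyperbolic, then the cyclic subgroup $\langle h\rangle$ generated by $h$ acts ergodically on $\mathbb{T}^n$ (via the linear action).
   Context: For $n\geq 1$, let $P_{n-1}(\mathbb{R})$ be the real vector space of homogeneous polynomials of degree $n-1$ in two variables $X,Y$, identified with $\mathbb{R}^n$ via the basis $X^{n-1},X^{n-2}Y,\ldots,Y^{n-1}$. The representation $\rho_{n-1}$ of $\operatorname{SL}_2(\mathbb{R})$ on $P_{n-1}(\mathbb{R})$ is $\big(\rho_{n-1}\begin{pmatrix}a&b\\c&d\end{pmatrix}P\big)(X,Y)=P(aX+cY,bX+dY)$. The lattice $P_{n-1}(\mathbb{Z})$ of integer-coefficient polynomials is $\rho_{n-1}(\operatorname{SL}_2(\mathbb{Z}))$-invariant, giving an action of $\operatorname{SL}_2(\mathbb{Z})$ on $\mathbb{T}^n=P_{n-1}(\mathbb{R})/P_{n-1}(\mathbb{Z})$; for $n$ odd it factors through $\operatorname{PSL}_2(\mathbb{Z})$. Set $G_n=\operatorname{SL}_2(\mathbb{Z})$ for $n$ even and $G_n=\operatorname{PSL}_2(\mathbb{Z})$ for $n$ odd; the resulting action $G_n\curvearrowright\mathbb{T}^n$ is called the linear action. It preserves normalized Lebesgue measure. A matrix $h\in\operatorname{SL}_2(\mathbb{Z})$ is hyperbolic if $|\operatorname{tr}(h)|>2$. 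*)

theory Defs
  imports "HOL-Analysis.Analysis" "HOL-Computational_Algebra.Polynomial"
begin

text \<open>Elements of SL_2(Z) as quadruples (a,b,c,d) standing for the matrix [[a,b],[c,d]].\<close>
type_synonym sl2 = "int \<times> int \<times> int \<times> int"

definition SL2Z :: "sl2 set" where
  "SL2Z = {(a,b,c,d). a * d - b * c = 1}"

fun sl2_mult :: "sl2 \<Rightarrow> sl2 \<Rightarrow> sl2" where
  "sl2_mult (a,b,c,d) (a',b',c',d') = (a*a' + b*c', a*b' + b*d', c*a' + d*c', c*b' + d*d')"

definition sl2_one :: sl2 where "sl2_one = (1,0,0,1)"

fun sl2_inv :: "sl2 \<Rightarrow> sl2" where
  "sl2_inv (a,b,c,d) = (d, -b, -c, a)"

fun sl2_pow :: "sl2 \<Rightarrow> nat \<Rightarrow> sl2" where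
  "sl2_pow h 0 = sl2_one"
| "sl2_pow h (Suc k) = sl2_mult h (sl2_pow h k)"

definition cyclic_subgroup :: "sl2 \<Rightarrow> sl2 set" where
  "cyclic_subgroup h = {sl2_pow h k | k. True} \<union> {sl2_pow (sl2_inv h) k | k. True}"

fun hyperbolic :: "sl2 \<Rightarrow> bool" where
  "hyperbolic (a,b,c,d) \<longleftrightarrow> \<bar>a + d\<bar> > 2"

text \<open>Matrix entry (i,j), 0 <= i,j < n, of rho_{n-1}(g) in the basis X^{n-1}, X^{n-2}Y, ..., Y^{n-1}:
  the coefficient of X^{n-1-i} Y^i in (aX+cY)^{n-1-j} (bX+dY)^j, computed by dehomogenising
  (Y := 1, X := t) as the coefficient of t^{n-1-i} in (a t + c)^{n-1-j} (b t + d)^j.\<close>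
fun rho :: "nat \<Rightarrow> sl2 \<Rightarrow> nat \<Rightarrow> nat \<Rightarrow> int" where
  "rho n (a,b,c,d) i j = coeff ([:c, a:] ^ (n - 1 - j) * [:d, b:] ^ j) (n - 1 - i)"

text \<open>The torus T^n = R^n / Z^n, modelled by the fundamental domain [0,1)^n
  (points are extensional functions on {..<n}), with normalized Lebesgue measure.\<close>
definition torus :: "nat \<Rightarrow> (nat \<Rightarrow> real) measure" where
  "torus n = PiM {..<n} (\<lambda>_. restrict_space lborel {0..<1})"

definition act :: "nat \<Rightarrow> sl2 \<Rightarrow> (nat \<Rightarrow> real) \<Rightarrow> (nat \<Rightarrow> real)" where
  "act n g x = (\<lambda>i\<in>{..<n}. frac (\<Sum>j<n. of_int (rho n g i j) * x j))"

definition ergodic_on :: "nat \<Rightarrow> sl2 set \<Rightarrow> bool" where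
  "ergodic_on n S \<longleftrightarrow>
     (\<forall>A \<in> sets (torus n). (\<forall>g\<in>S. act n g -` A \<inter> space (torus n) = A) \<longrightarrow>
        measure (torus n) A = 0 \<or> measure (torus n) A = 1)"

text \<open>Essential freeness of the action of G_n (= SL_2(Z) for n even, PSL_2(Z) for n odd):
  for a.e. x, the stabiliser of x in G_n is trivial, i.e. g x = x forces g = I, or g = \<plusminus>I when n is odd.\<close>
definition essentially_free :: "nat \<Rightarrow> bool" where
  "essentially_free n \<longleftrightarrow>
     (AE x in torus n. \<forall>g\<in>SL2Z. act n g x = x \<longrightarrow> g = (1,0,0,1) \<or> (odd n \<and> g = (-1,0,0,-1)))"

end

theory Submission
  imports Defs "HOL-Probability.Infinite_Product_Measure"
begin

text \<open>
  The action preserves Lebesgue measure and sends the character of frequency \<open>\<xi>\<close> to that of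
  frequency \<open>\<rho>(g)\<^sup>T \<xi>\<close>, so the Fourier coefficients of an invariant set are constant along orbits
  of this dual action. By Bessel's inequality they vanish on infinite orbits; if all orbits of
  nonzero frequencies are infinite, the indicator of the set is therefore constant almost everywhere.

  Up to binomial factors, the dual action is substitution in binary forms
  \<open>F(u,v) = \<Sum>\<^sub>j \<xi>\<^sub>j (n-1 choose j) u\<^sup>n\<^sup>-\<^sup>1\<^sup>-\<^sup>j v\<^sup>j\<close>. If the orbit of \<open>F\<close> under \<open>SL\<^sub>2(\<int>)\<close> is finite, then
  \<open>F(k,1)\<close> and \<open>F(1,k)\<close> take finitely many values over the integers \<open>k\<close>, which forces \<open>F = 0\<close>. If a
  hyperbolic matrix with eigenvalues \<open>\<lambda>\<^sup>\<plusminus>\<^sup>1\<close> fixes \<open>F\<close>, then in eigencoordinates each monomial of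
  \<open>F\<close> is multiplied by a power of \<open>\<lambda>\<close> whose exponent has the parity of \<open>n - 1\<close>; for \<open>n\<close> even
  it is nonzero, so again \<open>F = 0\<close>.
\<close>

section \<open>Trigonometric approximation on the circle\<close>

text \<open>Finite sums of modes with integer frequencies. Closure under products takes one
  induction per factor; \<open>trig_poly_sumE\<close> recovers the explicit sum when products over
  coordinates are expanded.\<close>

inductive trig_poly :: "(real \<Rightarrow> complex) \<Rightarrow> bool" where
  mode: "trig_poly (\<lambda>t. c * cis (2 * pi * (of_int k * t)))"
| add: "trig_poly f \<Longrightarrow> trig_poly g \<Longrightarrow> trig_poly (\<lambda>t. f t + g t)"

lemma trig_poly_const: "trig_poly (\<lambda>t. c)"
  using trig_poly.mode[of c 0] by simp

lemma trig_poly_mult_mode: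
  "trig_poly f \<Longrightarrow> trig_poly (\<lambda>t. c * cis (2 * pi * (of_int k * t)) * f t)"
proof (induction rule: trig_poly.induct)
  case (mode d l)
  have "(\<lambda>t. c * cis (2 * pi * (of_int k * t)) * (d * cis (2 * pi * (of_int l * t)))) =
        (\<lambda>t. (c * d) * cis (2 * pi * (of_int (k + l) * t)))"
    by (auto simp: fun_eq_iff algebra_simps simp flip: cis_mult)
  then show ?case using trig_poly.mode by metis
next
  case (add f g)
  then show ?case by (simp add: distrib_left trig_poly.add)
qed

lemma trig_poly_mult:
  "trig_poly f \<Longrightarrow> trig_poly g \<Longrightarrow> trig_poly (\<lambda>t. f t * g t)"
proof (induction rule: trig_poly.induct)
  case (mode c k)
  then show ?case by (rule trig_poly_mult_mode)
next
  case (add f g')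
  then show ?case by (simp add: distrib_right trig_poly.add)
qed

lemma trig_poly_sumE:
  assumes "trig_poly f"
  obtains K a where "finite K" "f = (\<lambda>t. \<Sum>k\<in>K. a k * cis (2 * pi * (of_int k * t)))"
proof -
  have "\<exists>K a. finite K \<and> f = (\<lambda>t. \<Sum>k\<in>K. a k * cis (2 * pi * (of_int k * t)))"
    using assms
  proof (induction rule: trig_poly.induct)
    case (mode c k)
    show ?case by (rule exI[of _ "{k}"], rule exI[of _ "\<lambda>_. c"]) simp
  next
    case (add f g)
    then obtain K a L b where fin: "finite K" "finite L"
      and f: "f = (\<lambda>t. \<Sum>k\<in>K. a k * cis (2 * pi * (of_int k * t)))"
      and g: "g = (\<lambda>t. \<Sum>k\<in>L. b k * cis (2 * pi * (of_int k * t)))"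
      by blast
    let ?c = "\<lambda>k. (if k \<in> K then a k else 0) + (if k \<in> L then b k else 0)"
    have "f t + g t = (\<Sum>k\<in>K \<union> L. ?c k * cis (2 * pi * (of_int k * t)))" for t
    proof -
      have "f t = (\<Sum>k\<in>K \<union> L. (if k \<in> K then a k else 0) * cis (2 * pi * (of_int k * t)))"
        unfolding f by (rule sum.mono_neutral_cong_left) (use fin in auto)
      moreover have "g t = (\<Sum>k\<in>K \<union> L. (if k \<in> L then b k else 0) * cis (2 * pi * (of_int k * t)))"
        unfolding g by (rule sum.mono_neutral_cong_left) (use fin in auto)
      ultimately show ?thesis by (simp only: distrib_right sum.distrib)
    qed
    then show ?case using fin by (intro exI[of _ "K \<union> L"] exI[of _ ?c]) auto
  qed
  then show thesis using that by blast
qed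

text \<open>Lets Stone-Weierstrass on the unit circle produce trigonometric polynomials: a linear
  functional of \<open>cis (2 * pi * t)\<close> combines cosine and sine, hence the modes 1 and -1,
  and sums and products stay in the class.\<close>

lemma trig_poly_of_real_polynomial_function:
  fixes g :: "complex \<Rightarrow> real"
  assumes "real_polynomial_function g"
  shows "trig_poly (\<lambda>t. complex_of_real (g (cis (2 * pi * t))))"
  using assms
proof (induction rule: real_polynomial_function.induct)
  case (linear f)
  then interpret bounded_linear f .
  \<comment> \<open>With z on the circle, cos = (z + 1/z)/2 and sin = (z - 1/z)/(2i) give these
    coefficients.\<close>
  have eq: "complex_of_real (f (cis (2 * pi * t))) =
      ((of_real (f 1) - \<i> * of_real (f \<i>)) / 2) * cis (2 * pi * (of_int 1 * t)) +
      ((of_real (f 1) + \<i> * of_real (f \<i>)) / 2) * cis (2 * pi * (of_int (-1) * t))" for t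
  proof -
    have "cis (2 * pi * t) = cos (2 * pi * t) *\<^sub>R 1 + sin (2 * pi * t) *\<^sub>R \<i>"
      by (simp add: complex_eq_iff)
    then have "f (cis (2 * pi * t)) = cos (2 * pi * t) * f 1 + sin (2 * pi * t) * f \<i>"
      by (simp add: add scaleR)
    then show ?thesis
      by (simp add: complex_eq_iff field_simps)
  qed
  show ?case unfolding eq by (intro trig_poly.intros)
next
  case (const c)
  show ?case by (rule trig_poly_const)
next
  case (add f g)
  then show ?case by (simp add: trig_poly.add)
next
  case (mult f g)
  then show ?case by (simp add: trig_poly_mult)
qed

lemma cis_2pi_eq_1_iff: "cis (2 * pi * t) = 1 \<longleftrightarrow> t \<in> \<int>"
proof
  assume "cis (2 * pi * t) = 1"
  then have "cos (2 * pi * t) = 1" by (simp add: complex_eq_iff)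
  then obtain k :: int where "2 * pi * t = k * 2 * pi" by (auto simp: cos_one_2pi_int)
  then have "t = k" by simp
  then show "t \<in> \<int>" by simp
qed simp

text \<open>Continuous cut-offs of the distance to the closed arc over \<open>{0..b}\<close>
  decrease to its indicator, and Stone-Weierstrass replaces each by a polynomial with error below
  \<open>1 / real (Suc k)\<close>. As \<open>b < 1\<close>, the arc does not close up, so no point
  of \<open>{0..<1}\<close> beyond \<open>b\<close> lands on it. The common bound 2 serves dominated
  convergence.\<close>

lemma trig_poly_approx_indicator:
  assumes "0 \<le> b" "b < 1"
  obtains p where "\<And>k::nat. trig_poly (p k)" "\<And>k t. norm (p k t) \<le> 2"
    "\<And>t. t \<in> {0..<1} \<Longrightarrow> (\<lambda>k. p k t) \<longlonglongrightarrow> of_real (indicator {0..b} t)"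
proof -
  define C where "C = (\<lambda>t. cis (2 * pi * t)) ` {0..b}"
  define g where "g k z = 1 - min 1 (real k * infdist z C)" for k z
  have "compact C"
    unfolding C_def by (intro compact_continuous_image continuous_intros) auto
  then have C: "closed C" "C \<noteq> {}" using assms by (auto simp: C_def compact_imp_closed)
  have mem_C: "cis (2 * pi * t) \<in> C \<longleftrightarrow> t \<le> b" if "t \<in> {0..<1}" for t
  proof
    assume "cis (2 * pi * t) \<in> C"
    then obtain s where s: "0 \<le> s" "s \<le> b" "cis (2 * pi * t) = cis (2 * pi * s)"
      by (auto simp: C_def)
    have "cis (2 * pi * (t - s)) = cis (2 * pi * t) / cis (2 * pi * s)"
      by (simp add: cis_divide algebra_simps)
    then have "t - s \<in> \<int>" using s by (simp flip: cis_2pi_eq_1_iff)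
    then have "t = s"
      using that s assms Ints_nonzero_abs_less1[of "t - s"] by auto
    then show "t \<le> b" using s by simp
  qed (use that in \<open>auto simp: C_def\<close>)
  have "\<exists>q. real_polynomial_function q \<and> (\<forall>z\<in>sphere 0 1. \<bar>g k z - q z\<bar> < 1 / real (Suc k))" for k
  proof -
    have "continuous_on (sphere 0 1) (g k)"
      unfolding g_def by (intro continuous_intros)
    from Stone_Weierstrass_real_polynomial_function[OF compact_sphere this, of "1 / real (Suc k)"]
    show ?thesis by (metis of_nat_0_less_iff zero_less_Suc zero_less_divide_1_iff)
  qed
  then obtain q where q: "\<And>k. real_polynomial_function (q k)"
    "\<And>k z. z \<in> sphere 0 1 \<Longrightarrow> \<bar>g k z - q k z\<bar> < 1 / real (Suc k)"
    by metis
  define p where "p k t = complex_of_real (q k (cis (2 * pi * t)))" for k t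
  show thesis
  proof
    show "trig_poly (p k)" for k
      unfolding p_def by (rule trig_poly_of_real_polynomial_function[OF q(1)])
    show "norm (p k t) \<le> 2" for k t
    proof -
      have "\<bar>g k (cis (2 * pi * t)) - q k (cis (2 * pi * t))\<bar> < 1 / real (Suc k)"
        by (rule q(2)) simp
      moreover have "1 / real (Suc k) \<le> 1" by simp
      moreover have "\<bar>g k (cis (2 * pi * t))\<bar> \<le> 1"
        using infdist_nonneg[of "cis (2 * pi * t)" C] by (auto simp: g_def min_def)
      ultimately have "\<bar>q k (cis (2 * pi * t))\<bar> \<le> 2" by linarith
      then show ?thesis by (simp add: p_def)
    qed
    fix t :: real assume t: "t \<in> {0..<1}"
    let ?z = "cis (2 * pi * t)"
    have "(\<lambda>k. g k ?z) \<longlonglongrightarrow> indicator {0..b} t"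
    proof (cases "t \<le> b")
      case True
      then show ?thesis using mem_C[OF t] t by (simp add: g_def)
    next
      case False
      then have "infdist ?z C > 0"
        using mem_C[OF t] C in_closed_iff_infdist_zero[of C ?z] infdist_nonneg[of ?z C] by auto
      \<comment> \<open>Off the closed arc the distance is positive, so the truncation by
        \<open>min\<close> makes \<open>g k\<close> exactly 0 from \<open>N\<close> on.\<close>
      then obtain N :: nat where N: "1 < real N * infdist ?z C"
        using reals_Archimedean3 by blast
      have "g k ?z = 0" if "k \<ge> N" for k
      proof -
        have "real N * infdist ?z C \<le> real k * infdist ?z C"
          using that by (intro mult_right_mono) (auto simp: infdist_nonneg)
        then show ?thesis using N by (simp add: g_def)
      qed
      then have "\<forall>\<^sub>F k in sequentially. g k ?z = 0"
        using eventually_sequentially by blast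
      then show ?thesis using False by (simp add: tendsto_eventually)
    qed
    moreover have "(\<lambda>k. g k ?z - q k ?z) \<longlonglongrightarrow> 0"
    proof (rule Lim_null_comparison)
      show "\<forall>\<^sub>F k in sequentially. norm (g k ?z - q k ?z) \<le> 1 / real (Suc k)"
        using q(2)[of ?z] by (auto intro!: always_eventually less_imp_le)
      show "(\<lambda>k. 1 / real (Suc k)) \<longlonglongrightarrow> 0"
        by (rule LIMSEQ_Suc) (rule lim_1_over_n)
    qed
    ultimately have "(\<lambda>k. g k ?z - (g k ?z - q k ?z)) \<longlonglongrightarrow> indicator {0..b} t - 0"
      by (rule tendsto_diff)
    then show "(\<lambda>k. p k t) \<longlonglongrightarrow> of_real (indicator {0..b} t)"
      unfolding p_def by (intro tendsto_of_real) simp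
  qed
qed

section \<open>Characters and measures on the torus\<close>

text \<open>Frequencies are functions on all naturals, but those agreeing below \<open>n\<close>
  give the same character. Wherever distinct frequencies are counted, they are therefore normalised
  to 0 from \<open>n\<close> on.\<close>

definition torus_char :: "nat \<Rightarrow> (nat \<Rightarrow> int) \<Rightarrow> (nat \<Rightarrow> real) \<Rightarrow> complex" where
  "torus_char n \<xi> x = cis (2 * pi * (\<Sum>i<n. of_int (\<xi> i) * x i))"

lemma cis_sum: "cis (\<Sum>i\<in>I. f i) = (\<Prod>i\<in>I. cis (f i))"
  by (induction I rule: infinite_finite_induct) (simp_all flip: cis_mult)

lemma torus_char_prod: "torus_char n \<xi> x = (\<Prod>i<n. cis (2 * pi * (of_int (\<xi> i) * x i)))"
  by (simp add: torus_char_def sum_distrib_left cis_sum)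

lemma norm_torus_char [simp]: "norm (torus_char n \<xi> x) = 1"
  by (simp add: torus_char_def)

lemma torus_char_diff: "torus_char n (\<lambda>i. \<xi> i - \<eta> i) x = torus_char n \<xi> x * cnj (torus_char n \<eta> x)"
  by (simp add: torus_char_def cis_cnj cis_mult algebra_simps sum_subtractf)

lemma space_torus: "space (torus n) = {..<n} \<rightarrow>\<^sub>E {0..<1}"
  by (simp add: torus_def space_PiM space_restrict_space)

lemma measurable_torus_component:
  "i < n \<Longrightarrow> (\<lambda>x. x i) \<in> borel_measurable (torus n)"
proof -
  assume "i < n"
  then have "(\<lambda>x. x i) \<in> torus n \<rightarrow>\<^sub>M restrict_space lborel {0..<1}"
    unfolding torus_def by (intro measurable_component_singleton) simp
  then have "(\<lambda>x. x i) \<in> torus n \<rightarrow>\<^sub>M lborel"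
    by (simp add: measurable_restrict_space2_iff)
  then show ?thesis by simp
qed

lemma measurable_cis [measurable]: "cis \<in> borel_measurable borel"
  by (intro borel_measurable_continuous_onI continuous_intros)

lemma measurable_torus_char [measurable]: "torus_char n \<xi> \<in> borel_measurable (torus n)"
  unfolding torus_char_def
  by (intro measurable_compose[OF _ measurable_cis] borel_measurable_times borel_measurable_const
      borel_measurable_sum measurable_torus_component) auto

lemma borel_measurable_trig_poly: "trig_poly f \<Longrightarrow> f \<in> borel_measurable borel"
  by (induction rule: trig_poly.induct) measurable

lemma prob_space_unit_interval: "prob_space (restrict_space lborel {0..<1::real})"
  by (rule prob_space_restrict_space) auto

lemma prob_space_torus: "prob_space (torus n)"
  unfolding torus_def by (intro prob_space_PiM prob_space_unit_interval)

section \<open>Generators of the Borel sets of the torus\<close>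

text \<open>Half-lines generate the Borel sets of the reals, and their traces on
  \<open>{0..<1}\<close> are empty, of the form \<open>{0..a}\<close>, or the whole
  interval.\<close>

lemma sets_unit_interval:
  "sets (restrict_space lborel {0..<1::real}) = sigma_sets {0..<1} {{0..b} | b. 0 \<le> b \<and> b < 1}"
    (is "_ = sigma_sets _ ?E")
proof -
  have "sets (borel :: real measure) = sigma_sets UNIV (range atMost)"
    by (subst borel_eq_atMost) simp
  then have "sets (restrict_space lborel {0..<1::real}) =
      (\<inter>) {0..<1} ` sigma_sets UNIV (range atMost)"
    by (simp add: sets_restrict_space)
  also have "\<dots> = sigma_sets {0..<1} ((\<inter>) {0..<1} ` range atMost)"
  proof (rule sigma_sets_Int)
    show "{0..<1::real} \<in> sigma_sets UNIV (range atMost)"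
      by (metis \<open>sets (borel :: real measure) = sigma_sets UNIV (range atMost)\<close> atLeastLessThan_borel)
  qed simp
  also have "\<dots> = sigma_sets {0..<1} ?E"
  proof (rule sigma_sets_eqI)
    fix A assume "A \<in> (\<inter>) {0..<1::real} ` range atMost"
    then obtain a where A: "A = {0..<1} \<inter> {..a}" by auto
    consider "a < 0" | "0 \<le> a" "a < 1" | "1 \<le> a" by linarith
    then show "A \<in> sigma_sets {0..<1} ?E"
    proof cases
      case 1
      then have "A = {}" using A by auto
      then show ?thesis by (simp add: sigma_sets.Empty)
    next
      case 2
      then have "A = {0..a}" using A by auto
      then show ?thesis using 2 by blast
    next
      case 3
      then have "A = {0..<1}" using A by auto
      then show ?thesis by (simp add: sigma_sets_top)
    qed
  next
    fix A assume "A \<in> ?E"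
    then obtain b :: real where "A = {0..b}" "0 \<le> b" "b < 1" by auto
    then have "A = {0..<1} \<inter> {..b}" by auto
    then show "A \<in> sigma_sets {0..<1} ((\<inter>) {0..<1} ` range atMost)" by blast
  qed
  finally show ?thesis .
qed

text \<open>The factors \<open>{0..b}\<close> with \<open>b < 1\<close> are closed arcs of the circle, so their indicators are pointwise
  limits of continuous periodic functions at every point of \<open>{0..<1}\<close>.\<close>
abbreviation corner_boxes :: "nat \<Rightarrow> (nat \<Rightarrow> real) set set" where
  "corner_boxes n \<equiv> {\<Pi>\<^sub>E i\<in>{..<n}. {0..b i} | b. \<forall>i<n. 0 \<le> b i \<and> b i < 1}"

text \<open>The whole interval is not of the form \<open>{0..b}\<close> with \<open>b < 1\<close>,
  so this exhaustion supplies the countable cover by generators that product sigma-algebras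
  require.\<close>

lemma UN_unit_interval: "(\<Union>k. {0..1 - 1 / real (Suc k)}) = {0..<1}"
proof (intro equalityI subsetI)
  fix t :: real assume t: "t \<in> {0..<1}"
  then obtain k where "1 / real (Suc k) < 1 - t"
    using nat_approx_posE[of "1 - t"] by auto
  then show "t \<in> (\<Union>k. {0..1 - 1 / real (Suc k)})" using t by (intro UN_I[of k]) auto
next
  fix t :: real assume "t \<in> (\<Union>k. {0..1 - 1 / real (Suc k)})"
  then obtain k where t: "t \<in> {0..1 - 1 / real (Suc k)}" by blast
  moreover have "t < 1"
    by (rule le_less_trans[of _ "1 - 1 / real (Suc k)"]) (use t in simp_all)
  ultimately show "t \<in> {0..<1}" by simp
qed

lemma PiE_restrict:
  assumes "\<And>i. i \<in> I \<Longrightarrow> A i \<subseteq> S"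
  shows "{f \<in> I \<rightarrow>\<^sub>E S. \<forall>i\<in>I. f i \<in> A i} = Pi\<^sub>E I A"
  using assms by (auto simp: PiE_iff extensional_def)

lemma corner_boxes_subset: "corner_boxes n \<subseteq> Pow ({..<n} \<rightarrow>\<^sub>E {0..<1})"
proof clarify
  fix b x :: "nat \<Rightarrow> real"
  assume b: "\<forall>i<n. 0 \<le> b i \<and> b i < 1" and x: "x \<in> (\<Pi>\<^sub>E i\<in>{..<n}. {0..b i})"
  have "(\<Pi>\<^sub>E i\<in>{..<n}. {0..b i}) \<subseteq> {..<n} \<rightarrow>\<^sub>E {0..<1}"
    by (rule PiE_mono) (use b in fastforce)
  then show "x \<in> {..<n} \<rightarrow>\<^sub>E {0..<1}" using x by blast
qed

lemma sets_torus: "sets (torus n) = sigma_sets ({..<n} \<rightarrow>\<^sub>E {0..<1}) (corner_boxes n)"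
proof -
  let ?E = "{{0..b} | b::real. 0 \<le> b \<and> b < 1}"
  have E: "?E \<subseteq> Pow {0..<1}" by auto
  have cover: "\<exists>S\<subseteq>?E. countable S \<and> {0..<1} = \<Union>S"
  proof (intro exI[of _ "range (\<lambda>k. {0..1 - 1 / real (Suc k)})"] conjI)
    show "range (\<lambda>k. {0..1 - 1 / real (Suc k)}) \<subseteq> ?E"
    proof clarify
      fix k
      have "0 \<le> 1 - 1 / real (Suc k)" "1 - 1 / real (Suc k) < 1" by simp_all
      then show "\<exists>b. {0..1 - 1 / real (Suc k)} = {0..b} \<and> 0 \<le> b \<and> b < 1" by blast
    qed
  qed (simp_all only: UN_unit_interval countable_image countableI_type)
  have "sets (torus n) = sets (\<Pi>\<^sub>M i\<in>{..<n}. sigma {0..<1} ?E)"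
    unfolding torus_def by (intro sets_PiM_cong refl) (use E in \<open>simp add: sets_unit_interval\<close>)
  \<comment> \<open>There are finitely many factors, so the single index set \<open>{..<n}\<close>
    suffices and the generating cylinders are full boxes.\<close>
  also have "\<dots> = sets (sigma ({..<n} \<rightarrow>\<^sub>E {0..<1})
      {{f \<in> {..<n} \<rightarrow>\<^sub>E {0..<1}. \<forall>i\<in>j. f i \<in> A i} | A j. j \<in> {{..<n}} \<and> A \<in> Pi j (\<lambda>_. ?E)})"
  proof (rule sets_PiM_sigma)
    show "\<exists>S\<subseteq>?E. countable S \<and> {0..<1} = \<Union>S" by (rule cover)
    show "?E \<subseteq> Pow {0..<1}" by (rule E)
  qed auto
  also have "{{f \<in> {..<n} \<rightarrow>\<^sub>E {0..<1}. \<forall>i\<in>j. f i \<in> A i} | A j. j \<in> {{..<n}} \<and> A \<in> Pi j (\<lambda>_. ?E)} = corner_boxes n"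
    (is "?L = _")
  proof (intro equalityI subsetI)
    fix X assume "X \<in> ?L"
    then obtain A where A: "X = {f \<in> {..<n} \<rightarrow>\<^sub>E {0..<1}. \<forall>i\<in>{..<n}. f i \<in> A i}" "A \<in> Pi {..<n} (\<lambda>_. ?E)"
      by blast
    from A(2) have "\<forall>i<n. \<exists>b. A i = {0..b} \<and> 0 \<le> b \<and> b < 1" by (auto simp: Pi_iff)
    then obtain b where b: "\<And>i. i < n \<Longrightarrow> A i = {0..b i} \<and> 0 \<le> b i \<and> b i < 1" by metis
    have "X = Pi\<^sub>E {..<n} A"
      unfolding A(1)
    proof (rule PiE_restrict)
      show "A i \<subseteq> {0..<1}" if "i \<in> {..<n}" for i
      proof -
        have "A i = {0..b i}" "b i < 1" using b that by auto
        then show ?thesis by auto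
      qed
    qed
    also have "\<dots> = (\<Pi>\<^sub>E i\<in>{..<n}. {0..b i})" by (rule PiE_cong) (use b in auto)
    finally show "X \<in> corner_boxes n" using b by blast
  next
    fix X assume "X \<in> corner_boxes n"
    then obtain b where b: "X = (\<Pi>\<^sub>E i\<in>{..<n}. {0..b i})" "\<forall>i<n. 0 \<le> b i \<and> b i < 1" by auto
    have "X = {f \<in> {..<n} \<rightarrow>\<^sub>E {0..<1}. \<forall>i\<in>{..<n}. f i \<in> {0..b i}}"
      unfolding b(1)
    proof (rule PiE_restrict[symmetric])
      show "{0..b i} \<subseteq> {0..<1}" if "i \<in> {..<n}" for i
      proof -
        have "b i < 1" using b that by auto
        then show ?thesis by auto
      qed
    qed
    moreover have "(\<lambda>i. {0..b i}) \<in> Pi {..<n} (\<lambda>_. ?E)"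
    proof
      fix i assume "i \<in> {..<n}"
      then have "0 \<le> b i \<and> b i < 1" using b by simp
      then show "{0..b i} \<in> ?E" by blast
    qed
    ultimately show "X \<in> ?L"
      by (intro CollectI exI[of _ "\<lambda>i. {0..b i}"] exI[of _ "{..<n}"] conjI) simp_all
  qed
  also have "sets (sigma ({..<n} \<rightarrow>\<^sub>E {0..<1}) (corner_boxes n)) =
      sigma_sets ({..<n} \<rightarrow>\<^sub>E {0..<1}) (corner_boxes n)"
    by (rule sets_measure_of[OF corner_boxes_subset])
  finally show ?thesis .
qed

section \<open>Fourier coefficients and uniqueness of measures\<close>

text \<open>By Fubini the integral splits into one-dimensional modes; for a nonzero frequency the
  antiderivative has period 1, so its end values cancel.\<close>

lemma integral_torus_char:
  "(\<integral>x. torus_char n \<xi> x \<partial>torus n) = (if \<forall>i<n. \<xi> i = 0 then 1 else 0)"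
proof -
  let ?I = "restrict_space lborel {0..<1::real}"
  interpret I: prob_space ?I by (rule prob_space_unit_interval)
  interpret product_sigma_finite "\<lambda>_. ?I" ..
  have mode: "(\<integral>t. cis (2 * pi * (of_int k * t)) \<partial>?I) = (if k = 0 then 1 else 0)" for k
  proof (cases "k = 0")
    case False
    define F where "F t = cis (2 * pi * (of_int k * t)) / (2 * pi * of_int k * \<i>)" for t
    have "(\<integral>t. cis (2 * pi * (of_int k * t)) \<partial>?I) =
        (\<integral>t. indicator {0..<1} t *\<^sub>R cis (2 * pi * (of_int k * t)) \<partial>lborel)"
      by (subst integral_restrict_space) auto
    \<comment> \<open>The null endpoint 1 is added because the fundamental theorem is applied on a
      closed interval.\<close>
    also have "\<dots> = (\<integral>t. indicator {0..1} t *\<^sub>R cis (2 * pi * (of_int k * t)) \<partial>lborel)"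
    proof (rule integral_cong_AE)
      show "AE t in lborel. indicator {0..<1} t *\<^sub>R cis (2 * pi * (of_int k * t)) =
          indicator {0..1} t *\<^sub>R cis (2 * pi * (of_int k * t))"
        using AE_lborel_singleton[of 1] by eventually_elim (auto simp: indicator_def)
    qed measurable
    also have "\<dots> = F 1 - F 0"
    proof (rule integral_FTC_atLeastAtMost)
      show "(F has_vector_derivative cis (2 * pi * (of_int k * t))) (at t within {0..1})" for t
      proof -
        let ?w = "2 * pi * of_int k * \<i> :: complex"
        have w: "?w \<noteq> 0" using False by simp
        have "((\<lambda>z. exp (?w * z) / ?w) has_field_derivative exp (?w * of_real t)) (at (of_real t))"
          by (rule derivative_eq_intros refl | use w in simp)+
        then have "((\<lambda>t. exp (?w * of_real t) / ?w) has_vector_derivative exp (?w * of_real t))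
            (at t within {0..1})"
          by (rule has_vector_derivative_real_field)
        then show ?thesis by (simp add: F_def[abs_def] cis_conv_exp mult_ac)
      qed
      show "continuous_on {0..1} (\<lambda>t. cis (2 * pi * (of_int k * t)))"
        by (intro continuous_intros)
    qed simp
    also have "\<dots> = 0" by (simp add: F_def)
    finally show ?thesis using False by simp
  next
    case True
    then show ?thesis using I.prob_space by (simp add: space_restrict_space)
  qed
  have "(\<integral>x. torus_char n \<xi> x \<partial>torus n) = (\<Prod>i<n. \<integral>t. cis (2 * pi * (of_int (\<xi> i) * t)) \<partial>?I)"
    unfolding torus_char_prod torus_def
  proof (rule product_integral_prod)
    show "integrable ?I (\<lambda>t. cis (2 * pi * (of_int (\<xi> i) * t)))" for i
      by (rule I.integrable_const_bound[of _ 1]) (auto intro!: borel_measurable_continuous_onI continuous_intros measurable_restrict_space1)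
  qed simp
  also have "\<dots> = (if \<forall>i<n. \<xi> i = 0 then 1 else 0)"
    unfolding mode by (auto intro!: prod.neutral)
  finally show ?thesis .
qed


lemma Int_stable_corner_boxes: "Int_stable (corner_boxes n)"
proof (rule Int_stableI)
  fix X Y assume "X \<in> corner_boxes n" "Y \<in> corner_boxes n"
  then obtain b c where "X = (\<Pi>\<^sub>E i\<in>{..<n}. {0..b i})" "Y = (\<Pi>\<^sub>E i\<in>{..<n}. {0..c i})"
    "\<forall>i<n. 0 \<le> b i \<and> b i < 1" "\<forall>i<n. 0 \<le> c i \<and> c i < 1" by auto
  then show "X \<inter> Y \<in> corner_boxes n"
    by (intro CollectI exI[of _ "\<lambda>i. min (b i) (c i)"]) (auto simp: PiE_Int Int_atLeastAtMost)
qed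

text \<open>Each coordinate eventually lies below the bound; as there are finitely many, one
  \<open>k\<close> serves them all.\<close>

lemma UN_corner_boxes:
  "(\<Union>k. \<Pi>\<^sub>E i\<in>{..<n}. {0..1 - 1 / real (Suc k)}) = ({..<n} \<rightarrow>\<^sub>E {0..<1} :: (nat \<Rightarrow> real) set)"
proof (intro equalityI subsetI)
  fix x :: "nat \<Rightarrow> real" assume x: "x \<in> {..<n} \<rightarrow>\<^sub>E {0..<1}"
  have "\<forall>\<^sub>F k in sequentially. x i \<le> 1 - 1 / real (Suc k)" if "i \<in> {..<n}" for i
  proof -
    have "(\<lambda>k. 1 - 1 / real (Suc k)) \<longlonglongrightarrow> 1 - 0"
      by (intro tendsto_diff tendsto_const LIMSEQ_Suc[OF lim_1_over_n])
    moreover have "x i < 1 - 0" using x that by (auto simp: PiE_iff)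
    ultimately have "\<forall>\<^sub>F k in sequentially. x i < 1 - 1 / real (Suc k)"
      by (rule order_tendstoD(1))
    then show ?thesis by (rule eventually_mono) simp
  qed
  then have "\<forall>\<^sub>F k in sequentially. \<forall>i\<in>{..<n}. x i \<le> 1 - 1 / real (Suc k)"
    by (intro eventually_ball_finite finite_lessThan ballI)
  then obtain k where "\<forall>i\<in>{..<n}. x i \<le> 1 - 1 / real (Suc k)"
    using eventually_happens'[OF sequentially_bot] by blast
  then have "x \<in> (\<Pi>\<^sub>E i\<in>{..<n}. {0..1 - 1 / real (Suc k)})"
    using x by (auto simp: PiE_iff)
  then show "x \<in> (\<Union>k. \<Pi>\<^sub>E i\<in>{..<n}. {0..1 - 1 / real (Suc k)})" by blast
next
  fix x :: "nat \<Rightarrow> real" assume "x \<in> (\<Union>k. \<Pi>\<^sub>E i\<in>{..<n}. {0..1 - 1 / real (Suc k)})"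
  then obtain k where "x \<in> (\<Pi>\<^sub>E i\<in>{..<n}. {0..1 - 1 / real (Suc k)})" by blast
  moreover have "{0..1 - 1 / real (Suc k)} \<subseteq> {0..<1}" using UN_unit_interval by blast
  ultimately show "x \<in> {..<n} \<rightarrow>\<^sub>E {0..<1}"
    using PiE_mono[of "{..<n}" "\<lambda>_. {0..1 - 1 / real (Suc k)}" "\<lambda>_. {0..<1}"] by blast
qed

text \<open>Distributing the product over the sums picks one frequency per coordinate, and every
  such pick is a character of the torus.\<close>

lemma prod_trig_poly_eq_sum_torus_char:
  assumes "\<And>i. i < n \<Longrightarrow> trig_poly (p i)"
  obtains F a where "finite F" "\<And>x. (\<Prod>i<n. p i (x i)) = (\<Sum>\<xi>\<in>F. a \<xi> * torus_char n \<xi> x)"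
proof -
  have "\<forall>i. \<exists>K a. i < n \<longrightarrow> finite K \<and> p i = (\<lambda>t. \<Sum>k\<in>K. a k * cis (2 * pi * (of_int k * t)))"
  proof
    fix i
    show "\<exists>K a. i < n \<longrightarrow> finite K \<and> p i = (\<lambda>t. \<Sum>k\<in>K. a k * cis (2 * pi * (of_int k * t)))"
    proof (cases "i < n")
      case True
      show ?thesis by (rule trig_poly_sumE[OF assms[OF True]]) blast
    qed simp
  qed
  then obtain K a where K: "\<And>i. i < n \<Longrightarrow> finite (K i)"
    and p: "\<And>i. i < n \<Longrightarrow> p i = (\<lambda>t. \<Sum>k\<in>K i. a i k * cis (2 * pi * (of_int k * t)))"
    by metis
  have "(\<Prod>i<n. p i (x i)) = (\<Sum>\<xi>\<in>PiE {..<n} K. (\<Prod>i<n. a i (\<xi> i)) * torus_char n \<xi> x)" for x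
  proof -
    have "(\<Prod>i<n. p i (x i)) = (\<Prod>i<n. \<Sum>k\<in>K i. a i k * cis (2 * pi * (of_int k * x i)))"
      by (intro prod.cong) (auto simp: p)
    also have "\<dots> = (\<Sum>\<xi>\<in>PiE {..<n} K. \<Prod>i<n. a i (\<xi> i) * cis (2 * pi * (of_int (\<xi> i) * x i)))"
      by (rule prod_sum_PiE) (use K in auto)
    finally show ?thesis by (simp add: torus_char_prod prod.distrib)
  qed
  moreover have "finite (PiE {..<n} K)" using K by (intro finite_PiE) auto
  ultimately show thesis by (rule that[rotated])
qed

lemma integrable_torus_char:
  assumes "finite_measure M" "sets M = sets (torus n)"
  shows "integrable M (torus_char n \<xi>)"
proof (rule finite_measure.integrable_const_bound[OF assms(1), of _ 1])
  show "torus_char n \<xi> \<in> borel_measurable M"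
    unfolding measurable_cong_sets[OF assms(2) refl] by (rule measurable_torus_char)
qed simp

text \<open>Products of one-dimensional approximations converge boundedly to indicators of corner
  boxes. Their integrals are combinations of Fourier coefficients, so the measures agree on boxes,
  an intersection-stable generator.\<close>

lemma torus_measure_eqI:
  assumes M: "finite_measure M" "sets M = sets (torus n)"
    and N: "finite_measure N" "sets N = sets (torus n)"
    and eq: "\<And>\<xi>. (\<integral>x. torus_char n \<xi> x \<partial>M) = (\<integral>x. torus_char n \<xi> x \<partial>N)"
  shows "M = N"
proof (rule measure_eqI_generator_eq)
  show "Int_stable (corner_boxes n)" by (rule Int_stable_corner_boxes)
  show "corner_boxes n \<subseteq> Pow ({..<n} \<rightarrow>\<^sub>E {0..<1})" by (rule corner_boxes_subset)
  show "sets M = sigma_sets ({..<n} \<rightarrow>\<^sub>E {0..<1}) (corner_boxes n)"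
    and "sets N = sigma_sets ({..<n} \<rightarrow>\<^sub>E {0..<1}) (corner_boxes n)"
    using M N by (simp_all add: sets_torus)
  show "range (\<lambda>k. \<Pi>\<^sub>E i\<in>{..<n}. {0..1 - 1 / real (Suc k)}) \<subseteq> corner_boxes n"
  proof clarify
    fix k
    have "0 \<le> 1 - 1 / real (Suc k)" "1 - 1 / real (Suc k) < 1" by simp_all
    then show "\<exists>b. (\<Pi>\<^sub>E i\<in>{..<n}. {0..1 - 1 / real (Suc k)}) = (\<Pi>\<^sub>E i\<in>{..<n}. {0..b i}) \<and>
        (\<forall>i<n. 0 \<le> b i \<and> b i < 1)"
      by (intro exI[of _ "\<lambda>_. 1 - 1 / real (Suc k)"]) blast
  qed
  show "(\<Union>k. \<Pi>\<^sub>E i\<in>{..<n}. {0..1 - 1 / real (Suc k)}) = {..<n} \<rightarrow>\<^sub>E {0..<1}"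
    by (rule UN_corner_boxes)
  show "emeasure M X \<noteq> \<infinity>" for X using finite_measure.emeasure_finite[OF M(1)] by simp
  fix X assume X: "X \<in> corner_boxes n"
  then obtain b where b: "X = (\<Pi>\<^sub>E i\<in>{..<n}. {0..b i})" "\<And>i. i < n \<Longrightarrow> 0 \<le> b i \<and> b i < 1" by auto
  have "\<forall>i. \<exists>p. i < n \<longrightarrow> (\<forall>k. trig_poly (p k)) \<and> (\<forall>k t. norm (p k t) \<le> 2) \<and>
      (\<forall>t\<in>{0..<1}. (\<lambda>k::nat. p k t) \<longlonglongrightarrow> of_real (indicator {0..b i} t))"
  proof
    fix i
    show "\<exists>p. i < n \<longrightarrow> (\<forall>k. trig_poly (p k)) \<and> (\<forall>k t. norm (p k t) \<le> 2) \<and>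
      (\<forall>t\<in>{0..<1}. (\<lambda>k::nat. p k t) \<longlonglongrightarrow> of_real (indicator {0..b i} t))"
    proof (cases "i < n")
      case True
      then have "0 \<le> b i" "b i < 1" using b(2) by auto
      then show ?thesis by (rule trig_poly_approx_indicator) blast
    qed simp
  qed
  then obtain p where p: "\<And>i k. i < n \<Longrightarrow> trig_poly (p i k)" "\<And>i k t. i < n \<Longrightarrow> norm (p i k t) \<le> 2"
    "\<And>i t. i < n \<Longrightarrow> t \<in> {0..<1} \<Longrightarrow> (\<lambda>k::nat. p i k t) \<longlonglongrightarrow> of_real (indicator {0..b i} t)"
    by metis
  let ?P = "\<lambda>k x. \<Prod>i<n. p i k (x i)"
  \<comment> \<open>Convergence holds at every point of the torus and not merely almost everywhere,
    so one argument covers any finite measure, in particular both \<open>M\<close> and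
    \<open>N\<close>.\<close>
  have lim: "(\<lambda>k. \<integral>x. ?P k x \<partial>Q) \<longlonglongrightarrow> of_real (measure Q X)"
    if Q: "finite_measure Q" "sets Q = sets (torus n)" for Q
  proof -
    have sp: "space Q = space (torus n)" using Q(2) by (rule sets_eq_imp_space_eq)
    have XQ: "X \<in> sets Q" using X Q by (auto simp: sets_torus)
    have "(\<lambda>k. \<integral>x. ?P k x \<partial>Q) \<longlonglongrightarrow> (\<integral>x. complex_of_real (indicator X x) \<partial>Q)"
    proof (rule integral_dominated_convergence)
      show "(\<lambda>x. complex_of_real (indicator X x)) \<in> borel_measurable Q" using XQ by measurable
      show "integrable Q (\<lambda>x. 2 ^ n)" using Q by (simp add: finite_measure.integrable_const)
      show "?P k \<in> borel_measurable Q" for k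
        unfolding measurable_cong_sets[OF Q(2) refl]
        by (intro borel_measurable_prod measurable_compose[OF measurable_torus_component
              borel_measurable_trig_poly[OF p(1)]]) auto
      show "AE x in Q. norm (?P k x) \<le> 2 ^ n" for k
      proof (rule AE_I2)
        fix x
        have "norm (?P k x) = (\<Prod>i<n. norm (p i k (x i)))" by (simp add: prod_norm)
        also have "\<dots> \<le> (\<Prod>i<n. 2)" by (rule prod_mono) (use p(2) in auto)
        finally show "norm (?P k x) \<le> 2 ^ n" by simp
      qed
      show "AE x in Q. (\<lambda>k. ?P k x) \<longlonglongrightarrow> complex_of_real (indicator X x)"
      proof (rule AE_I2)
        fix x assume "x \<in> space Q"
        then have x: "x \<in> {..<n} \<rightarrow>\<^sub>E {0..<1}" by (simp add: sp space_torus)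
        have "(\<lambda>k. ?P k x) \<longlonglongrightarrow> (\<Prod>i<n. of_real (indicator {0..b i} (x i)))"
        proof (rule tendsto_prod)
          fix i assume "i \<in> {..<n}"
          then have "i < n" "x i \<in> {0..<1}" using x by (auto simp: PiE_iff)
          then show "(\<lambda>k. p i k (x i)) \<longlonglongrightarrow> of_real (indicator {0..b i} (x i))" by (rule p(3))
        qed
        also have "(\<Prod>i<n. complex_of_real (indicator {0..b i} (x i))) = of_real (indicator X x)"
        proof (cases "x \<in> X")
          case True
          then show ?thesis by (auto simp: b(1) indicator_def PiE_iff intro!: prod.neutral)
        next
          case False
          then obtain i where "i < n" "x i \<notin> {0..b i}" using x by (auto simp: b(1) PiE_iff)
          then have "(\<Prod>i<n. complex_of_real (indicator {0..b i} (x i))) = 0"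
            by (intro prod_zero) (auto intro!: bexI[of _ i])
          then show ?thesis using False by simp
        qed
        finally show "(\<lambda>k. ?P k x) \<longlonglongrightarrow> complex_of_real (indicator X x)" .
      qed
    qed
    also have "(\<integral>x. complex_of_real (indicator X x) \<partial>Q) = of_real (measure Q X)"
      using XQ by (simp add: sets.Int_space_eq2)
    finally show ?thesis .
  qed
  have "(\<integral>x. ?P k x \<partial>M) = (\<integral>x. ?P k x \<partial>N)" for k
  proof -
    obtain F a where F: "finite F" "\<And>x. ?P k x = (\<Sum>\<xi>\<in>F. a \<xi> * torus_char n \<xi> x)"
      by (rule prod_trig_poly_eq_sum_torus_char[of n "\<lambda>i. p i k"]) (use p(1) in auto)
    have "(\<integral>x. ?P k x \<partial>Q) = (\<Sum>\<xi>\<in>F. a \<xi> * (\<integral>x. torus_char n \<xi> x \<partial>Q))"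
      if "finite_measure Q" "sets Q = sets (torus n)" for Q
      unfolding F(2) by (subst Bochner_Integration.integral_sum)
        (auto intro!: integrable_mult_right integrable_torus_char that)
    then show ?thesis using M N eq by simp
  qed
  then have "(\<lambda>k. \<integral>x. ?P k x \<partial>N) \<longlonglongrightarrow> of_real (measure M X)"
    using lim[OF M] by simp
  from LIMSEQ_unique[OF this lim[OF N]] have "measure M X = measure N X"
    by (simp only: of_real_eq_iff)
  then show "emeasure M X = emeasure N X"
    using M(1) N(1) by (simp add: finite_measure.emeasure_eq_measure)
qed

section \<open>The dual action on binary forms\<close>

text \<open>The transpose of \<open>rho n g\<close> applied to the frequency. The value 0 from
  \<open>n\<close> on makes distinct orbit elements distinct characters.\<close>

definition dual :: "nat \<Rightarrow> sl2 \<Rightarrow> (nat \<Rightarrow> int) \<Rightarrow> (nat \<Rightarrow> int)" where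
  "dual n g \<xi> = (\<lambda>j. if j < n then \<Sum>i<n. \<xi> i * rho n g i j else 0)"

text \<open>The pairing of \<xi> with the coefficient vector of (uX + vY)^(n-1), whence the binomial
  factors. Since \<open>rho\<close> sends this power to ((au + bv)X + (cu + dv)Y)^(n-1), the
  transposed action becomes substitution.\<close>

definition binary_form :: "nat \<Rightarrow> (nat \<Rightarrow> int) \<Rightarrow> real \<Rightarrow> real \<Rightarrow> real" where
  "binary_form n \<xi> u v =
     (\<Sum>j<n. of_int (\<xi> j) * of_nat ((n - 1) choose j) * u ^ (n - 1 - j) * v ^ j)"

lemma of_int_coeff_mult_linear_powers:
  "real_of_int (coeff ([:c, a:] ^ p * [:d, b:] ^ q) m) =
   coeff ([:of_int c, of_int a:] ^ p * [:of_int d, of_int b:] ^ q) m"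
proof -
  have *: "real_of_int (coeff ([:c, a:] ^ p) i) = coeff ([:of_int c, of_int a:] ^ p) i" for c a p i
  proof (cases "i \<le> p")
    case True
    then show ?thesis by (simp add: coeff_linear_poly_power)
  next
    case False
    have "degree ([:c, a:] ^ p) < i" "degree ([:real_of_int c, of_int a:] ^ p) < i"
      using False by (auto intro!: le_less_trans[OF degree_power_le])
    then show ?thesis by (simp add: coeff_eq_0)
  qed
  show ?thesis by (simp add: coeff_mult *)
qed

text \<open>With X = t and Y = 1, compare coefficients of t^(n-1-i) after expanding (u(at + c) +
  v(bt + d))^(n-1) binomially in its two summands.\<close>

lemma sum_rho_binomial:
  assumes "i < n"
  shows "(\<Sum>j<n. of_int (rho n (a,b,c,d) i j) * of_nat ((n - 1) choose j) * u ^ (n - 1 - j) * v ^ j) =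
    of_nat ((n - 1) choose i) * (of_int a * u + of_int b * v) ^ (n - 1 - i) * (of_int c * u + of_int d * v :: real) ^ i"
proof -
  define N where "N = n - 1"
  have n: "n = Suc N" and i: "i \<le> N" using assms by (auto simp: N_def)
  let ?p = "[:of_int c, of_int a:] :: real poly" and ?q = "[:of_int d, of_int b:] :: real poly"
  have "[:of_int c * u + of_int d * v, of_int a * u + of_int b * v:] ^ N = (smult v ?q + smult u ?p) ^ N"
    by (simp add: algebra_simps)
  also have "\<dots> = (\<Sum>j\<le>N. of_nat (N choose j) * smult v ?q ^ j * smult u ?p ^ (N - j))"
    by (rule binomial_ring)
  also have "\<dots> = (\<Sum>j\<le>N. smult (of_nat (N choose j) * u ^ (N - j) * v ^ j) (?p ^ (N - j) * ?q ^ j))"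
    by (intro sum.cong refl)
       (simp only: smult_power of_nat_poly mult_smult_left mult_smult_right smult_smult
          mult_1_left mult_pCons_left mult_zero_left smult_0_right pCons_0_0 add_0_right mult_ac)
  finally have "coeff ([:of_int c * u + of_int d * v, of_int a * u + of_int b * v:] ^ N) (N - i) =
    (\<Sum>j\<le>N. (of_nat (N choose j) * u ^ (N - j) * v ^ j) * coeff (?p ^ (N - j) * ?q ^ j) (N - i))"
    by (simp add: coeff_sum)
  also have "\<dots> = (\<Sum>j\<le>N. of_int (rho n (a,b,c,d) i j) * of_nat (N choose j) * u ^ (N - j) * v ^ j)"
    by (intro sum.cong) (auto simp: n of_int_coeff_mult_linear_powers mult_ac)
  also have "coeff ([:of_int c * u + of_int d * v, of_int a * u + of_int b * v:] ^ N) (N - i) =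
    of_nat (N choose i) * (of_int a * u + of_int b * v) ^ (N - i) * (of_int c * u + of_int d * v) ^ i"
    using i binomial_symmetric[OF i] by (simp add: coeff_linear_poly_power)
  finally show ?thesis by (simp add: n lessThan_Suc_atMost)
qed

lemma binary_form_dual:
  "binary_form n (dual n (a,b,c,d) \<xi>) u v =
   binary_form n \<xi> (of_int a * u + of_int b * v) (of_int c * u + of_int d * v)"
proof -
  have "binary_form n (dual n (a,b,c,d) \<xi>) u v =
    (\<Sum>j<n. \<Sum>i<n. of_int (\<xi> i) * (of_int (rho n (a,b,c,d) i j) * of_nat ((n - 1) choose j) * u ^ (n - 1 - j) * v ^ j))"
    unfolding binary_form_def dual_def
    by (intro sum.cong) (auto simp: sum_distrib_left sum_distrib_right mult_ac simp del: rho.simps)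
  also have "\<dots> = (\<Sum>i<n. of_int (\<xi> i) * (\<Sum>j<n. of_int (rho n (a,b,c,d) i j) * of_nat ((n - 1) choose j) * u ^ (n - 1 - j) * v ^ j))"
    by (subst sum.swap) (simp add: sum_distrib_left)
  also have "\<dots> = binary_form n \<xi> (of_int a * u + of_int b * v) (of_int c * u + of_int d * v)"
    unfolding binary_form_def
    by (intro sum.cong refl) (subst sum_rho_binomial, simp_all only: lessThan_iff mult.assoc)
  finally show ?thesis .
qed

section \<open>Dehomogenised forms and orbits under SL_2(Z)\<close>

definition right_poly :: "nat \<Rightarrow> (nat \<Rightarrow> int) \<Rightarrow> real poly" where
  "right_poly n \<xi> = (\<Sum>j<n. monom (of_int (\<xi> j) * of_nat ((n - 1) choose j)) j)"

lemma poly_right_poly: "poly (right_poly n \<xi>) v = binary_form n \<xi> 1 v"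
  by (simp add: right_poly_def binary_form_def poly_sum poly_monom)

lemma coeff_right_poly:
  "coeff (right_poly n \<xi>) j = (if j < n then of_int (\<xi> j) * of_nat ((n - 1) choose j) else 0)"
  by (simp add: right_poly_def coeff_sum sum.delta)

definition left_poly :: "nat \<Rightarrow> (nat \<Rightarrow> int) \<Rightarrow> real poly" where
  "left_poly n \<xi> = (\<Sum>j<n. monom (of_int (\<xi> j) * of_nat ((n - 1) choose j)) (n - 1 - j))"

lemma poly_left_poly: "poly (left_poly n \<xi>) u = binary_form n \<xi> u 1"
  by (simp add: left_poly_def binary_form_def poly_sum poly_monom)

lemma coeff_left_poly:
  assumes "j < n"
  shows "coeff (left_poly n \<xi>) (n - 1 - j) = of_int (\<xi> j) * of_nat ((n - 1) choose j)"
proof -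
  have "coeff (left_poly n \<xi>) (n - 1 - j) =
      (\<Sum>i<n. if i = j then of_int (\<xi> i) * of_nat ((n - 1) choose i) else 0)"
    unfolding left_poly_def coeff_sum coeff_monom by (intro sum.cong) (use assms in auto)
  then show ?thesis using assms by (simp add: sum.delta)
qed

lemma right_poly_eq_0_iff: "right_poly n \<xi> = 0 \<longleftrightarrow> (\<forall>j<n. \<xi> j = 0)"
proof
  assume "right_poly n \<xi> = 0"
  then have "of_int (\<xi> j) * real (n - 1 choose j) = 0" if "j < n" for j
    using coeff_right_poly[of n \<xi> j] that by simp
  moreover have "real (n - 1 choose j) \<noteq> 0" if "j < n" for j
    using that by simp
  ultimately show "\<forall>j<n. \<xi> j = 0" by (metis mult_eq_0_iff of_int_eq_0_iff)
qed (simp add: poly_eq_iff coeff_right_poly)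

lemma binary_form_scale:
  assumes "n \<ge> 1"
  shows "binary_form n \<xi> (c * u) (c * v) = c ^ (n - 1) * binary_form n \<xi> u v"
  unfolding binary_form_def sum_distrib_left
proof (intro sum.cong refl)
  fix j assume "j \<in> {..<n}"
  then have "c ^ (n - 1) = c ^ (n - 1 - j) * c ^ j" by (auto simp flip: power_add)
  then show "of_int (\<xi> j) * of_nat (n - 1 choose j) * (c * u) ^ (n - 1 - j) * (c * v) ^ j =
      c ^ (n - 1) * (of_int (\<xi> j) * of_nat (n - 1 choose j) * u ^ (n - 1 - j) * v ^ j)"
    by (simp add: power_mult_distrib)
qed

text \<open>By pigeonhole some value is taken infinitely often, and subtracting it leaves a
  polynomial with infinitely many roots.\<close>

lemma poly_const_if_finite_image:
  fixes p :: "real poly"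
  assumes "infinite A" "finite (poly p ` A)"
  shows "p = [:coeff p 0:]"
proof -
  obtain y where "infinite {x\<in>A. poly p x = y}"
    using pigeonhole_infinite[OF assms] by force
  then have "infinite {x. poly (p - [:y:]) x = 0}"
    by (elim infinite_super[rotated]) auto
  then have "p - [:y:] = 0" using poly_roots_finite by blast
  then show ?thesis by (metis coeff_pCons_0 eq_iff_diff_eq_0)
qed

lemma infinite_range_of_int: "infinite (range (of_int :: int \<Rightarrow> real))"
  by (simp add: finite_image_iff inj_on_def infinite_UNIV_int)

text \<open>Lower and upper unipotent matrices move (1,0) to (1,k) and (0,1) to (k,1). A finite
  orbit thus makes both dehomogenisations constant: \<open>right_poly\<close> then kills every
  coefficient except the one at index 0, and \<open>left_poly\<close> kills that one.\<close>

lemma dual_orbit_SL2Z_infinite: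
  assumes "n \<ge> 2" "\<exists>j<n. \<xi> j \<noteq> 0"
  shows "infinite ((\<lambda>g. dual n g \<xi>) ` SL2Z)"
proof
  assume fin: "finite ((\<lambda>g. dual n g \<xi>) ` SL2Z)"
  have R: "right_poly n \<xi> = [:coeff (right_poly n \<xi>) 0:]"
  proof (rule poly_const_if_finite_image[OF infinite_range_of_int])
    have "poly (right_poly n \<xi>) (of_int k) = (\<lambda>\<eta>. binary_form n \<eta> 1 0) (dual n (1,0,k,1) \<xi>)" for k
      by (simp add: poly_right_poly binary_form_dual)
    then have "poly (right_poly n \<xi>) ` range of_int \<subseteq>
        (\<lambda>\<eta>. binary_form n \<eta> 1 0) ` (\<lambda>g. dual n g \<xi>) ` SL2Z"
      by (auto simp: SL2Z_def)
    then show "finite (poly (right_poly n \<xi>) ` range of_int)"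
      using fin finite_subset by blast
  qed
  have L: "left_poly n \<xi> = [:coeff (left_poly n \<xi>) 0:]"
  proof (rule poly_const_if_finite_image[OF infinite_range_of_int])
    have "poly (left_poly n \<xi>) (of_int k) = (\<lambda>\<eta>. binary_form n \<eta> 0 1) (dual n (1,k,0,1) \<xi>)" for k
      by (simp add: poly_left_poly binary_form_dual)
    then have "poly (left_poly n \<xi>) ` range of_int \<subseteq>
        (\<lambda>\<eta>. binary_form n \<eta> 0 1) ` (\<lambda>g. dual n g \<xi>) ` SL2Z"
      by (auto simp: SL2Z_def)
    then show "finite (poly (left_poly n \<xi>) ` range of_int)"
      using fin finite_subset by blast
  qed
  have "\<xi> j = 0" if j: "j < n" for j
  proof (cases "j = 0")
    case True
    \<comment> \<open>Here \<open>n \<ge> 2\<close> enters: the power \<open>n - 1\<close> carrying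
      index 0 is not the constant term.\<close>
    have "coeff (left_poly n \<xi>) (n - 1) = 0"
      using assms(1) by (subst L) (simp add: coeff_pCons split: nat.split)
    then show ?thesis using True coeff_left_poly[of 0 n \<xi>] assms by simp
  next
    case False
    then have "coeff (right_poly n \<xi>) j = 0"
      by (subst R) (simp add: coeff_pCons split: nat.split)
    then show ?thesis using j by (auto simp: coeff_right_poly)
  qed
  then show False using assms by blast
qed

text \<open>Substitution by an invertible matrix loses nothing: the inverse substitution recovers
  the original form.\<close>

lemma dual_eq_0_imp:
  assumes "g \<in> SL2Z" "\<forall>j<n. dual n g \<xi> j = 0"
  shows "\<forall>j<n. \<xi> j = 0"
proof -
  obtain a b c d where g: "g = (a,b,c,d)" by (cases g)
  have det: "real_of_int a * of_int d - of_int b * of_int c = 1"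
    using assms(1) g by (auto simp: SL2Z_def simp flip: of_int_mult of_int_diff)
  have "binary_form n \<xi> u v = 0" for u v
  proof -
    \<comment> \<open>The inverse matrix applied to (u,v).\<close>
    let ?u = "of_int d * u - of_int b * v" and ?v = "of_int a * v - of_int c * u"
    have "of_int a * ?u + of_int b * ?v = (of_int a * of_int d - of_int b * of_int c) * u"
         "of_int c * ?u + of_int d * ?v = (of_int a * of_int d - of_int b * of_int c) * v"
      by (simp_all add: algebra_simps)
    then have "binary_form n \<xi> u v = binary_form n (dual n g \<xi>) ?u ?v"
      unfolding g binary_form_dual by (simp add: det)
    also have "\<dots> = 0" using assms(2) by (simp add: binary_form_def)
    finally show ?thesis .
  qed
  then have "right_poly n \<xi> = 0"
    by (simp add: poly_right_poly flip: poly_all_0_iff_0)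
  then show ?thesis by (simp add: right_poly_eq_0_iff)
qed

section \<open>Invariant sets and fixed points\<close>

lemma measurable_act: "act n g \<in> torus n \<rightarrow>\<^sub>M torus n"
proof -
  have "(\<lambda>x. frac (\<Sum>j<n. of_int (rho n g i j) * x j)) \<in> torus n \<rightarrow>\<^sub>M restrict_space lborel {0..<1}" for i
  proof (rule measurable_restrict_space2)
    have "(\<lambda>x. \<Sum>j<n. of_int (rho n g i j) * x j) \<in> borel_measurable (torus n)"
      by (intro borel_measurable_sum borel_measurable_times borel_measurable_const
          measurable_torus_component) simp
    then show "(\<lambda>x. frac (\<Sum>j<n. of_int (rho n g i j) * x j)) \<in> torus n \<rightarrow>\<^sub>M lborel"
      unfolding frac_def by measurable
  qed (auto simp: frac_lt_1)
  then have "(\<lambda>x. \<lambda>i\<in>{..<n}. frac (\<Sum>j<n. of_int (rho n g i j) * x j)) \<in>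
      torus n \<rightarrow>\<^sub>M Pi\<^sub>M {..<n} (\<lambda>_. restrict_space lborel {0..<1})"
    by (intro measurable_restrict)
  then show ?thesis by (simp add: act_def[abs_def] torus_def)
qed

text \<open>The integer parts removed by \<open>frac\<close> change the phase by 2 pi times an
  integer, which a character does not see.\<close>

lemma torus_char_act: "torus_char n \<xi> (act n g x) = torus_char n (dual n g \<xi>) x"
proof -
  define y where "y i = (\<Sum>j<n. real_of_int (rho n g i j) * x j)" for i
  define m where "m = (\<Sum>i<n. \<xi> i * \<lfloor>y i\<rfloor>)"
  have "(\<Sum>i<n. of_int (\<xi> i) * act n g x i) = (\<Sum>i<n. of_int (\<xi> i) * y i) - of_int m"
    by (simp add: act_def y_def m_def frac_def right_diff_distrib sum_subtractf)
  also have "(\<Sum>i<n. of_int (\<xi> i) * y i) = (\<Sum>j<n. of_int (dual n g \<xi> j) * x j)"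
  proof -
    have "(\<Sum>i<n. of_int (\<xi> i) * y i) = (\<Sum>i<n. \<Sum>j<n. of_int (\<xi> i * rho n g i j) * x j)"
      by (simp add: y_def sum_distrib_left mult.assoc)
    also have "\<dots> = (\<Sum>j<n. \<Sum>i<n. of_int (\<xi> i * rho n g i j) * x j)" by (rule sum.swap)
    also have "\<dots> = (\<Sum>j<n. of_int (dual n g \<xi> j) * x j)"
      by (intro sum.cong) (simp_all add: dual_def sum_distrib_right)
    finally show ?thesis .
  qed
  finally have *: "(\<Sum>i<n. of_int (\<xi> i) * act n g x i) = (\<Sum>j<n. of_int (dual n g \<xi> j) * x j) - of_int m" .
  have "torus_char n \<xi> (act n g x) =
      cis (2 * pi * (\<Sum>j<n. of_int (dual n g \<xi> j) * x j)) / cis (2 * pi * of_int m)"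
    unfolding torus_char_def * by (simp only: right_diff_distrib cis_divide)
  then show ?thesis by (simp add: torus_char_def)
qed

text \<open>Instead of a change of variables: both measures have the same Fourier coefficients, since the
  dual action sends no nonzero frequency to zero.\<close>
lemma distr_act:
  assumes "g \<in> SL2Z"
  shows "distr (torus n) (torus n) (act n g) = torus n"
proof (rule torus_measure_eqI)
  interpret prob_space "torus n" by (rule prob_space_torus)
  show "finite_measure (distr (torus n) (torus n) (act n g))"
    by (intro finite_measure_distr measurable_act)
  show "finite_measure (torus n)" by (rule finite_measure_axioms)
  fix \<xi>
  have "(\<forall>i<n. dual n g \<xi> i = 0) \<longleftrightarrow> (\<forall>i<n. \<xi> i = 0)"
    using dual_eq_0_imp[OF assms] by (auto simp: dual_def)
  then show "(\<integral>x. torus_char n \<xi> x \<partial>distr (torus n) (torus n) (act n g)) = (\<integral>x. torus_char n \<xi> x \<partial>torus n)"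
    by (simp add: integral_distr[OF measurable_act measurable_torus_char] torus_char_act integral_torus_char)
qed simp_all

text \<open>Summing \<open>r\<^sup>2\<close> of the characters to \<open>S\<close> gives \<open>r\<^sup>2 \<bar>c\<bar> \<le> \<integral>\<bar>S\<bar> \<le> r\<close> by orthogonality, as \<open>\<bar>S\<bar> \<le> (\<bar>S\<bar>\<^sup>2 / r + r) / 2\<close>.\<close>
lemma equal_Fourier_coefficients_eq_0:
  assumes A: "A \<in> sets (torus n)" and K: "infinite K" "\<And>\<xi> i. \<xi> \<in> K \<Longrightarrow> i \<ge> n \<Longrightarrow> \<xi> i = 0"
    and c: "\<And>\<xi>. \<xi> \<in> K \<Longrightarrow> (\<integral>x. indicator A x *\<^sub>R torus_char n \<xi> x \<partial>torus n) = c"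
  shows "c = 0"
proof (rule ccontr)
  assume "c \<noteq> 0"
  \<comment> \<open>Chosen so large that the bound r^2 |c| \<le> r fails.\<close>
  then obtain r :: nat where r: "1 < real r * norm c" using reals_Archimedean3[of "norm c"] by auto
  then have r0: "r > 0" by (cases r) auto
  interpret prob_space "torus n" by (rule prob_space_torus)
  have int: "integrable (torus n) (torus_char n \<xi>)" for \<xi>
    by (rule integrable_torus_char) (auto intro: finite_measure_axioms)
  obtain F where F: "finite F" "card F = r * r" "F \<subseteq> K"
    using infinite_arbitrarily_large[OF K(1)] by blast
  define S where "S x = (\<Sum>\<xi>\<in>F. torus_char n \<xi> x)" for x
  have S_meas: "S \<in> borel_measurable (torus n)"
    unfolding S_def by (intro borel_measurable_sum measurable_torus_char)
  have S_int: "integrable (torus n) S"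
    unfolding S_def by (intro Bochner_Integration.integrable_sum int)
  have norm_S: "norm (S x) \<le> r * r" for x
    unfolding S_def using norm_sum[of "\<lambda>\<xi>. torus_char n \<xi> x" F] F by simp
  have sq_int: "integrable (torus n) (\<lambda>x. (norm (S x))\<^sup>2)"
    using S_meas power_mono[OF norm_S norm_ge_zero, of _ 2]
    by (intro integrable_const_bound[of _ "(r * r)\<^sup>2"]) auto
  have "complex_of_real (\<integral>x. (norm (S x))\<^sup>2 \<partial>torus n) = (\<integral>x. S x * cnj (S x) \<partial>torus n)"
    by (simp only: complex_norm_square integral_complex_of_real[symmetric])
  also have "\<dots> = (\<integral>x. (\<Sum>\<xi>\<in>F. \<Sum>\<eta>\<in>F. torus_char n (\<lambda>i. \<xi> i - \<eta> i) x) \<partial>torus n)"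
    by (simp add: S_def sum_product torus_char_diff)
  also have "\<dots> = (\<Sum>\<xi>\<in>F. \<Sum>\<eta>\<in>F. \<integral>x. torus_char n (\<lambda>i. \<xi> i - \<eta> i) x \<partial>torus n)"
    by (subst Bochner_Integration.integral_sum; intro Bochner_Integration.integrable_sum int sum.cong refl
        Bochner_Integration.integral_sum)
  also have "\<dots> = (\<Sum>\<xi>\<in>F. \<Sum>\<eta>\<in>F. if \<xi> = \<eta> then 1 else 0)"
  proof (intro sum.cong refl)
    fix \<xi> \<eta> assume "\<xi> \<in> F" "\<eta> \<in> F"
    \<comment> \<open>Members of \<open>K\<close> vanish from \<open>n\<close> on, so agreement
      below \<open>n\<close> is equality of functions.\<close>
    then have "(\<forall>i<n. \<xi> i - \<eta> i = 0) \<longleftrightarrow> \<xi> = \<eta>"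
      using K(2) F(3) by (auto simp: fun_eq_iff) (metis leI subsetD)
    then show "(\<integral>x. torus_char n (\<lambda>i. \<xi> i - \<eta> i) x \<partial>torus n) = (if \<xi> = \<eta> then 1 else 0)"
      by (simp add: integral_torus_char)
  qed
  also have "\<dots> = complex_of_real (real (r * r))" using F by simp
  finally have sq: "(\<integral>x. (norm (S x))\<^sup>2 \<partial>torus n) = real (r * r)" by (simp only: of_real_eq_iff)
  have indS: "integrable (torus n) (\<lambda>x. indicator A x *\<^sub>R S x)"
    using S_int A by (rule integrable_mult_indicator[rotated])
  have "real (r * r) * c = (\<Sum>\<xi>\<in>F. \<integral>x. indicator A x *\<^sub>R torus_char n \<xi> x \<partial>torus n)"
    using c F by (simp add: subset_iff)
  also have "\<dots> = (\<integral>x. indicator A x *\<^sub>R S x \<partial>torus n)"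
    unfolding S_def scaleR_sum_right
    by (rule Bochner_Integration.integral_sum[symmetric]) (intro integrable_mult_indicator A int)
  finally have "real (r * r) * norm c = norm (\<integral>x. indicator A x *\<^sub>R S x \<partial>torus n)"
    by (metis norm_mult norm_of_real of_real_of_nat_eq abs_of_nat)
  also have "\<dots> \<le> (\<integral>x. norm (indicator A x *\<^sub>R S x) \<partial>torus n)"
    by (rule integral_norm_bound)
  also have "\<dots> \<le> (\<integral>x. ((norm (S x))\<^sup>2 / r + r) / 2 \<partial>torus n)"
  proof (rule integral_mono)
    show "integrable (torus n) (\<lambda>x. norm (indicator A x *\<^sub>R S x))" using indS by (rule integrable_norm)
    show "integrable (torus n) (\<lambda>x. ((norm (S x))\<^sup>2 / r + r) / 2)" using sq_int by simp
    fix x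
    have "0 \<le> (norm (S x) - r)\<^sup>2" by simp
    then have "norm (S x) \<le> ((norm (S x))\<^sup>2 / r + r) / 2"
      using r0 by (simp add: field_simps power2_eq_square)
    moreover have "norm (indicator A x *\<^sub>R S x) \<le> norm (S x)" by (simp add: indicator_def)
    ultimately show "norm (indicator A x *\<^sub>R S x) \<le> ((norm (S x))\<^sup>2 / r + r) / 2" by linarith
  qed
  also have "\<dots> = (real (r * r) / r + r) / 2"
    using sq_int by (simp add: sq prob_space)
  also have "\<dots> = r" using r0 by simp
  finally have "real r * (real r * norm c) \<le> real r * 1" by simp
  then show False using r r0 by simp
qed

text \<open>Invariance of \<open>A\<close> and of Lebesgue measure makes the Fourier coefficients of
  its indicator constant on dual orbits, hence 0 on infinite ones. The restriction of the measure to
  \<open>A\<close> then has the same coefficients as a constant multiple of Lebesgue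
  measure.\<close>

lemma ergodic_on_if_dual_orbits_infinite:
  assumes S: "S \<subseteq> SL2Z"
    and orbits: "\<And>\<xi>. \<exists>j<n. \<xi> j \<noteq> 0 \<Longrightarrow> infinite ((\<lambda>g. dual n g \<xi>) ` S)"
  shows "ergodic_on n S"
  unfolding ergodic_on_def
proof (intro ballI impI)
  fix A assume A: "A \<in> sets (torus n)" and inv: "\<forall>g\<in>S. act n g -` A \<inter> space (torus n) = A"
  interpret prob_space "torus n" by (rule prob_space_torus)
  define a where "a = measure (torus n) A"
  define M where "M = density (torus n) (\<lambda>x. ennreal (indicator A x))"
  define N where "N = density (torus n) (\<lambda>_. ennreal a)"
  have a: "0 \<le> a" "a \<le> 1" by (simp_all add: a_def)
  have "M = N"
  proof (rule torus_measure_eqI)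
    show "finite_measure M"
    proof
      show "emeasure M (space M) \<noteq> \<infinity>"
        using A emeasure_finite[of A]
        by (simp add: M_def emeasure_density ennreal_indicator nn_integral_indicator flip: indicator_inter_arith)
    qed
    show "finite_measure N"
      by standard (simp add: N_def emeasure_density nn_integral_cmult ennreal_mult_eq_top_iff)
    show "sets M = sets (torus n)" "sets N = sets (torus n)" by (simp_all add: M_def N_def)
    fix \<xi>
    have int_M: "(\<integral>x. torus_char n \<eta> x \<partial>M) = (\<integral>x. indicator A x *\<^sub>R torus_char n \<eta> x \<partial>torus n)" for \<eta>
      unfolding M_def using A by (intro integral_density measurable_torus_char) auto
    have int_N: "(\<integral>x. torus_char n \<xi> x \<partial>N) = a *\<^sub>R (\<integral>x. torus_char n \<xi> x \<partial>torus n)"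
      unfolding N_def using a by (subst integral_density[OF measurable_torus_char]) auto
    show "(\<integral>x. torus_char n \<xi> x \<partial>M) = (\<integral>x. torus_char n \<xi> x \<partial>N)"
    proof (cases "\<forall>j<n. \<xi> j = 0")
      case True
      then have "torus_char n \<xi> x = 1" for x by (simp add: torus_char_def)
      then show ?thesis
        unfolding int_M int_N using A True
        by (simp add: a_def integral_torus_char scaleR_conv_of_real sets.Int_space_eq2)
    next
      case False
      then have "infinite ((\<lambda>g. dual n g \<xi>) ` S)" using orbits by blast
      moreover have "(\<integral>x. indicator A x *\<^sub>R torus_char n \<eta> x \<partial>torus n) =
          (\<integral>x. indicator A x *\<^sub>R torus_char n \<xi> x \<partial>torus n)" if \<eta>: "\<eta> \<in> (\<lambda>g. dual n g \<xi>) ` S" for \<eta>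
      proof -
        obtain g where g: "g \<in> S" "\<eta> = dual n g \<xi>" using \<eta> by blast
        have "(\<integral>x. indicator A x *\<^sub>R torus_char n \<xi> x \<partial>torus n) =
            (\<integral>x. indicator A x *\<^sub>R torus_char n \<xi> x \<partial>distr (torus n) (torus n) (act n g))"
          using g S by (subst distr_act) auto
        also have "\<dots> = (\<integral>x. indicator A (act n g x) *\<^sub>R torus_char n \<xi> (act n g x) \<partial>torus n)"
          using A by (intro integral_distr measurable_act borel_measurable_scaleR
              borel_measurable_indicator measurable_torus_char)
        also have "\<dots> = (\<integral>x. indicator A x *\<^sub>R torus_char n \<eta> x \<partial>torus n)"
        proof (rule Bochner_Integration.integral_cong[OF refl])
          fix x assume "x \<in> space (torus n)"
          then have "act n g x \<in> A \<longleftrightarrow> x \<in> A" using inv g(1) by blast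
          then show "indicator A (act n g x) *\<^sub>R torus_char n \<xi> (act n g x) = indicator A x *\<^sub>R torus_char n \<eta> x"
            by (simp add: g(2) torus_char_act indicator_def)
        qed
        finally show ?thesis by simp
      qed
      ultimately have "(\<integral>x. indicator A x *\<^sub>R torus_char n \<xi> x \<partial>torus n) = 0"
        by (intro equal_Fourier_coefficients_eq_0[OF A]) (auto simp: dual_def)
      then show ?thesis using False by (auto simp: int_M int_N integral_torus_char)
    qed
  qed
  \<comment> \<open>Evaluating both measures on \<open>A\<close> itself gives a = a^2.\<close>
  then have "(\<integral>x. indicator A x \<partial>M) = (\<integral>x. (indicator A x :: real) \<partial>N)" by (rule arg_cong)
  moreover have "(\<integral>x. indicator A x \<partial>M) = a"
    unfolding M_def using A by (subst integral_density) (auto simp: a_def sets.Int_space_eq2 simp flip: indicator_inter_arith)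
  moreover have "(\<integral>x. indicator A x \<partial>N) = a * a"
    unfolding N_def using A a by (subst integral_density) (auto simp: a_def sets.Int_space_eq2)
  ultimately have "a = a * a" by (simp only:)
  then have "a * (a - 1) = 0" by (simp add: right_diff_distrib)
  then show "measure (torus n) A = 0 \<or> measure (torus n) A = 1" by (simp add: a_def)
qed

section \<open>Null sets of fixed points\<close>

text \<open>On the exceptional set all characters of frequency \<open>k \<eta>\<close> equal 1, so its Fourier coefficients at
  these frequencies agree.\<close>
lemma AE_integer_combination_not_integer:
  assumes \<eta>: "j < n" "\<eta> j \<noteq> 0"
  shows "AE x in torus n. (\<Sum>i<n. of_int (\<eta> i) * x i) \<notin> \<int>"
proof -
  interpret prob_space "torus n" by (rule prob_space_torus)
  define B where "B = {x \<in> space (torus n). torus_char n \<eta> x = 1}"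
  have B: "B \<in> sets (torus n)"
    unfolding B_def using measurable_torus_char by measurable
  \<comment> \<open>The multiples of \<eta>, cut off at \<open>n\<close> as the Fourier lemma
    demands; coordinate \<open>j\<close> tells them apart.\<close>
  define K where "K k = (\<lambda>i. if i < n then int k * \<eta> i else 0)" for k
  have "inj K"
  proof (rule injI)
    fix k l assume "K k = K l"
    then have "K k j = K l j" by simp
    then show "k = l" using \<eta> by (simp add: K_def)
  qed
  then have "infinite (range K)" by (rule range_inj_infinite)
  moreover have "(\<integral>x. indicator B x *\<^sub>R torus_char n \<xi> x \<partial>torus n) = of_real (measure (torus n) B)"
    if \<xi>: "\<xi> \<in> range K" for \<xi>
  proof -
    obtain k where k: "\<xi> = K k" using \<xi> by blast
    have "torus_char n \<xi> x = torus_char n \<eta> x ^ k" for x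
    proof -
      have "(\<Sum>i<n. of_int (\<xi> i) * x i) = real k * (\<Sum>i<n. of_int (\<eta> i) * x i)"
        by (simp add: k K_def sum_distrib_left mult.assoc)
      then show ?thesis by (simp only: torus_char_def Complex.DeMoivre mult.left_commute[of "real k"])
    qed
    then have "(\<integral>x. indicator B x *\<^sub>R torus_char n \<xi> x \<partial>torus n) = (\<integral>x. complex_of_real (indicator B x) \<partial>torus n)"
      by (intro Bochner_Integration.integral_cong) (auto simp: B_def indicator_def)
    then show ?thesis using B by (simp add: sets.Int_space_eq2)
  qed
  ultimately have "complex_of_real (measure (torus n) B) = 0"
    by (intro equal_Fourier_coefficients_eq_0[OF B]) (auto simp: K_def)
  then have "emeasure (torus n) B = 0" by (simp add: emeasure_eq_measure)
  then have "AE x in torus n. x \<notin> B" using B by (intro AE_not_in) auto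
  then show ?thesis
  proof (rule AE_mp, intro AE_I2 impI)
    fix x assume "x \<in> space (torus n)" "x \<notin> B"
    then show "(\<Sum>i<n. of_int (\<eta> i) * x i) \<notin> \<int>"
      by (simp add: B_def torus_char_def cis_2pi_eq_1_iff)
  qed
qed

text \<open>At a fixed point, row \<open>i\<close> of \<open>rho n g\<close> minus the identity
  takes an integer value; that row is nonzero at column \<open>j\<close>.\<close>

lemma AE_not_fixed:
  assumes "i < n" "j < n" "rho n g i j \<noteq> (if i = j then 1 else 0)"
  shows "AE x in torus n. act n g x \<noteq> x"
proof -
  define \<eta> where "\<eta> k = rho n g i k - (if i = k then 1 else 0)" for k
  have "AE x in torus n. (\<Sum>k<n. of_int (\<eta> k) * x k) \<notin> \<int>"
    by (rule AE_integer_combination_not_integer[OF assms(2)]) (use assms in \<open>auto simp: \<eta>_def\<close>)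
  then show ?thesis
  proof (rule AE_mp, intro AE_I2 impI notI)
    fix x assume notin: "(\<Sum>k<n. of_int (\<eta> k) * x k) \<notin> \<int>" and fixed: "act n g x = x"
    define y where "y = (\<Sum>k<n. of_int (rho n g i k) * x k)"
    have "(\<Sum>k<n. of_int (\<eta> k) * x k) = y - (\<Sum>k<n. if i = k then x k else 0)"
      unfolding y_def sum_subtractf[symmetric] by (intro sum.cong) (auto simp: \<eta>_def algebra_simps)
    also have "\<dots> = y - x i" using assms(1) by simp
    also have "x i = frac y" using fun_cong[OF fixed, of i] assms(1) by (simp add: act_def y_def)
    finally show False using notin by (simp add: frac_def)
  qed
qed

section \<open>Hyperbolic elements\<close>

lemma sl2_mult_SL2Z:
  assumes "g \<in> SL2Z" "h \<in> SL2Z"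
  shows "sl2_mult g h \<in> SL2Z"
proof -
  obtain a b c d a' b' c' d' where gh: "g = (a,b,c,d)" "h = (a',b',c',d')"
    by (metis prod_cases4)
  have "(a*a' + b*c') * (c*b' + d*d') - (a*b' + b*d') * (c*a' + d*c') =
      (a * d - b * c) * (a' * d' - b' * c')"
    by (simp add: algebra_simps)
  then show ?thesis using assms by (simp add: gh SL2Z_def)
qed

lemma sl2_pow_SL2Z: "h \<in> SL2Z \<Longrightarrow> sl2_pow h k \<in> SL2Z"
  by (induction k) (simp_all add: sl2_mult_SL2Z, simp add: sl2_one_def SL2Z_def)

lemma cyclic_subgroup_subset_SL2Z:
  assumes "h \<in> SL2Z"
  shows "cyclic_subgroup h \<subseteq> SL2Z"
proof -
  have "sl2_inv h \<in> SL2Z" using assms by (cases h) (simp add: SL2Z_def mult.commute)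
  then show ?thesis using assms by (auto simp: cyclic_subgroup_def sl2_pow_SL2Z)
qed

text \<open>The vector \<open>(b, r - a)\<close> is scaled by \<open>r\<close>: the first row is an
  identity, and the second, cb + d(r - a) = dr - 1 = r(r - a), uses the determinant and the
  characteristic equation. Powers follow by induction.\<close>

lemma sl2_pow_eigenvector:
  fixes r :: real
  assumes "a * d - b * c = 1" "r\<^sup>2 = of_int (a + d) * r - 1" "sl2_pow (a,b,c,d) k = (a',b',c',d')"
  shows "of_int a' * of_int b + of_int b' * (r - of_int a) = r ^ k * of_int b \<and>
    of_int c' * of_int b + of_int d' * (r - of_int a) = r ^ k * (r - of_int a)"
  using assms(3)
proof (induction k arbitrary: a' b' c' d')
  case 0
  then show ?case by (simp add: sl2_one_def)
next
  case (Suc k)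
  obtain p q s t where pow: "sl2_pow (a,b,c,d) k = (p,q,s,t)" by (metis prod_cases4)
  note IH = Suc.IH[OF pow]
  have eqs: "a' = a * p + b * s" "b' = a * q + b * t" "c' = c * p + d * s" "d' = c * q + d * t"
    using Suc.prems by (simp_all add: pow)
  let ?b = "of_int b :: real"
  have det: "of_int c * ?b = of_int a * of_int d - 1"
    using assms(1) by (metis (no_types) add_diff_cancel_left' diff_add_cancel mult.commute of_int_1 of_int_diff of_int_mult diff_diff_eq2)
  have "of_int a' * ?b + of_int b' * (r - of_int a) =
      of_int a * (of_int p * ?b + of_int q * (r - of_int a)) + ?b * (of_int s * ?b + of_int t * (r - of_int a))"
    by (simp add: eqs algebra_simps)
  also have "\<dots> = r ^ Suc k * ?b"
    by (simp only: IH[THEN conjunct1] IH[THEN conjunct2]) (simp add: algebra_simps)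
  finally have 1: "of_int a' * ?b + of_int b' * (r - of_int a) = r ^ Suc k * ?b" .
  have "of_int c' * ?b + of_int d' * (r - of_int a) =
      of_int c * (of_int p * ?b + of_int q * (r - of_int a)) + of_int d * (of_int s * ?b + of_int t * (r - of_int a))"
    by (simp add: eqs algebra_simps)
  also have "\<dots> = r ^ k * (of_int c * ?b + of_int d * (r - of_int a))"
    by (simp only: IH[THEN conjunct1] IH[THEN conjunct2]) (simp add: algebra_simps)
  also have "of_int c * ?b + of_int d * (r - of_int a) = of_int d * r - 1"
    by (simp add: det right_diff_distrib)
  also have "\<dots> = r * (r - of_int a)"
    using assms(2) by (simp add: power2_eq_square algebra_simps)
  finally show ?case using 1 by simp
qed

lemma hyperbolic_eigenvalues:
  fixes T :: real
  assumes "\<bar>T\<bar> > 2"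
  obtains r s :: real where "r + s = T" "r * s = 1" "\<bar>r\<bar> > 1"
proof -
  define q where "q = sqrt (T\<^sup>2 - 4)"
  have "2\<^sup>2 < T\<^sup>2" using assms by (metis abs_numeral power2_abs power_strict_mono pos2 zero_le_numeral abs_ge_zero)
  then have q: "q > 0" "q\<^sup>2 = T\<^sup>2 - 4" by (auto simp: q_def)
  \<comment> \<open>The sign of the trace selects the root of larger absolute value: with it,
    \<open>T\<close> and \<open>e * q\<close> add up without cancellation.\<close>
  define e where "e = sgn T"
  have e: "e\<^sup>2 = 1" "e * T = \<bar>T\<bar>" "\<bar>e\<bar> = 1" using assms by (auto simp: e_def sgn_if)
  show thesis
  proof
    show "(T + e * q) / 2 + (T - e * q) / 2 = T" by (simp add: field_simps)
    have "(T + e * q) * (T - e * q) = T\<^sup>2 - e\<^sup>2 * q\<^sup>2" by (simp add: algebra_simps power2_eq_square)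
    then show "(T + e * q) / 2 * ((T - e * q) / 2) = 1" by (simp add: e q)
    have "\<bar>e * (T + e * q)\<bar> = \<bar>T\<bar> + q"
      using e q by (simp add: distrib_left power2_eq_square flip: mult.assoc)
    then have "\<bar>T + e * q\<bar> = \<bar>T\<bar> + q" using e by (simp add: abs_mult)
    then show "1 < \<bar>(T + e * q) / 2\<bar>" using assms q by simp
  qed
qed

text \<open>A nonzero coefficient at index i would force r^(2i) = r^N, impossible for
  \<open>N\<close> odd because powers of |r| > 1 determine their exponent.\<close>

lemma poly_eq_0_if_scaling:
  fixes Q :: "real poly"
  assumes "\<bar>r\<bar> > 1" "odd N" "\<And>s. poly Q (r\<^sup>2 * s) = r ^ N * poly Q s"
  shows "Q = 0"
proof (rule poly_eqI)
  fix i
  have "pcompose Q [:0, r\<^sup>2:] = smult (r ^ N) Q"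
    by (rule poly_eq_poly_eq_iff[THEN iffD1]) (simp add: fun_eq_iff poly_pcompose assms(3) mult.commute[of _ "r\<^sup>2"])
  then have "(r\<^sup>2) ^ i * coeff Q i = r ^ N * coeff Q i"
    by (metis coeff_pcompose_linear coeff_smult)
  moreover have "(r\<^sup>2) ^ i \<noteq> r ^ N"
  proof
    assume "(r\<^sup>2) ^ i = r ^ N"
    then have "\<bar>r\<bar> ^ (2 * i) = \<bar>r\<bar> ^ N" by (metis power_abs power_mult)
    then have "2 * i = N" using assms(1) by (simp add: power_inject_exp)
    then show False using assms(2) by auto
  qed
  ultimately show "coeff Q i = coeff 0 i" by simp
qed

text \<open>In eigencoordinates the coincidence reads G(x,y) = G(Rx, y/R) with R = r^(l-k).
  Homogeneity of odd degree \<open>n - 1\<close> turns this into the scaling law excluded for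
  nonzero polynomials by \<open>poly_eq_0_if_scaling\<close>.\<close>

lemma dual_sl2_pow_eq_imp:
  assumes n: "even n" "n \<ge> 2" and h: "h \<in> SL2Z" "hyperbolic h" and kl: "k < l"
    and eq: "dual n (sl2_pow h k) \<xi> = dual n (sl2_pow h l) \<xi>"
  shows "\<forall>j<n. \<xi> j = 0"
proof -
  obtain a b c d where h_eq: "h = (a,b,c,d)" by (metis prod_cases4)
  have det: "a * d - b * c = 1" and tr: "\<bar>a + d\<bar> > 2" using h by (auto simp: h_eq SL2Z_def)
  \<comment> \<open>If b = 0, then a = d = 1 or a = d = -1, and the trace is not hyperbolic. So the
    vectors \<open>(b, r - a)\<close> and \<open>(b, s - a)\<close> are nonzero.\<close>
  have b: "b \<noteq> 0"
  proof
    assume "b = 0"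
    then have "a * d = 1" using det by simp
    then show False using tr by (auto simp: zmult_eq_1_iff)
  qed
  have "\<bar>real_of_int (a + d)\<bar> > 2" using tr by linarith
  then obtain r s where rs: "r + s = real_of_int (a + d)" "r * s = 1" "\<bar>r\<bar> > 1"
    by (rule hyperbolic_eigenvalues)
  have char: "r\<^sup>2 = of_int (a + d) * r - 1" "s\<^sup>2 = of_int (a + d) * s - 1"
    using rs(2) unfolding rs(1)[symmetric] by (simp_all add: power2_eq_square algebra_simps)
  have "r \<noteq> s"
  proof
    assume "r = s"
    then have "\<bar>r\<bar> * \<bar>r\<bar> = 1" using rs(2) by (simp flip: abs_mult)
    then show False using rs(3) less_1_mult[of "\<bar>r\<bar>" "\<bar>r\<bar>"] by simp
  qed
  have r0: "r \<noteq> 0" using rs(2) by auto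
  \<comment> \<open>the binary form in the eigencoordinates of \<open>h\<close>, with eigenvectors \<open>(b, r - a)\<close> and \<open>(b, s - a)\<close>\<close>
  define G where "G x y = binary_form n \<xi> (of_int b * (x + y)) ((r - of_int a) * x + (s - of_int a) * y)" for x y
  have G_pow: "binary_form n (dual n (sl2_pow h i) \<xi>) (of_int b * (x + y)) ((r - of_int a) * x + (s - of_int a) * y)
      = G (r ^ i * x) (s ^ i * y)" for i x y
  proof -
    obtain a' b' c' d' where p: "sl2_pow (a,b,c,d) i = (a',b',c',d')" by (metis prod_cases4)
    note E = sl2_pow_eigenvector[OF det char(1) p] sl2_pow_eigenvector[OF det char(2) p]
    have "of_int a' * (of_int b * (x + y)) + of_int b' * ((r - of_int a) * x + (s - of_int a) * y) =
        (of_int a' * of_int b + of_int b' * (r - of_int a)) * x +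
        (of_int a' * of_int b + of_int b' * (s - of_int a)) * y"
      by (simp add: algebra_simps)
    also have "\<dots> = of_int b * (r ^ i * x + s ^ i * y)"
      by (simp only: E[THEN conjunct1] E[THEN conjunct2]) (simp add: algebra_simps)
    finally have 1: "of_int a' * (of_int b * (x + y)) + of_int b' * ((r - of_int a) * x + (s - of_int a) * y) =
      of_int b * (r ^ i * x + s ^ i * y)" .
    have "of_int c' * (of_int b * (x + y)) + of_int d' * ((r - of_int a) * x + (s - of_int a) * y) =
        (of_int c' * of_int b + of_int d' * (r - of_int a)) * x +
        (of_int c' * of_int b + of_int d' * (s - of_int a)) * y"
      by (simp add: algebra_simps)
    also have "\<dots> = (r - of_int a) * (r ^ i * x) + (s - of_int a) * (s ^ i * y)"

      by (simp only: E[THEN conjunct1] E[THEN conjunct2]) (simp add: algebra_simps)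
    finally show ?thesis by (simp only: h_eq p binary_form_dual 1 G_def)
  qed
  define m where "m = l - k"
  define R where "R = r ^ m"
  have sR: "s ^ m = 1 / R"
    using rs(2) r0 by (simp add: R_def field_simps flip: power_mult_distrib)
  have R: "\<bar>R\<bar> > 1"
    using rs(3) kl by (simp add: R_def m_def power_abs one_less_power)
  have inv: "r ^ k * s ^ k = 1" using rs(2) by (simp flip: power_mult_distrib)
  have G_inv: "G x y = G (R * x) (y / R)" for x y
  proof -
    \<comment> \<open>The arguments are pre-multiplied by \<open>s ^ k\<close> and
      \<open>r ^ k\<close> so that the k-th powers cancel, as \<open>r * s = 1\<close>.\<close>
    have "G (r ^ k * (s ^ k * x)) (s ^ k * (r ^ k * y)) = G (r ^ l * (s ^ k * x)) (s ^ l * (r ^ k * y))"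
      unfolding G_pow[symmetric] eq ..
    moreover have "r ^ k * (s ^ k * x) = x" "s ^ k * (r ^ k * y) = y"
      using inv by (simp_all add: mult.commute mult.left_commute flip: mult.assoc)
    moreover have "r ^ l = R * r ^ k" "s ^ l = s ^ m * s ^ k"
      using kl by (simp_all add: R_def m_def flip: power_add)
    then have "r ^ l * (s ^ k * x) = R * (r ^ k * s ^ k) * x" "s ^ l * (r ^ k * y) = s ^ m * (r ^ k * s ^ k) * y"
      by simp_all
    ultimately show ?thesis by (simp add: inv sR)
  qed
  have G_scale: "G (t * x) (t * y) = t ^ (n - 1) * G x y" for t x y
  proof -
    have "G (t * x) (t * y) = binary_form n \<xi> (t * (of_int b * (x + y))) (t * ((r - of_int a) * x + (s - of_int a) * y))"
      by (simp add: G_def algebra_simps)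
    then show ?thesis using n(2) by (simp add: G_def binary_form_scale)
  qed
  \<comment> \<open>This is G(x,1) written as a polynomial in x.\<close>
  define Q where "Q = (\<Sum>j<n. smult (of_int (\<xi> j) * of_nat ((n - 1) choose j))
      ([:of_int b, of_int b:] ^ (n - 1 - j) * [:s - of_int a, r - of_int a:] ^ j))"
  have Q: "poly Q x = G x 1" for x
    unfolding Q_def G_def binary_form_def poly_sum
    by (intro sum.cong) (simp_all add: algebra_simps)
  have "Q = 0"
  proof (rule poly_eq_0_if_scaling[OF R])
    show "odd (n - 1)" using n by simp
    fix x
    \<comment> \<open>The point (Rx, 1/R) is 1/R times (R^2 x, 1), so homogeneity returns to the
      line y = 1.\<close>
    have "R * x = 1 / R * (R\<^sup>2 * x)" "1 / R = 1 / R * 1"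
      using R by (auto simp: power2_eq_square)
    then have "G x 1 = (1 / R) ^ (n - 1) * G (R\<^sup>2 * x) 1"
      using G_inv[of x 1] G_scale[of "1 / R" "R\<^sup>2 * x" 1] by simp
    then show "poly Q (R\<^sup>2 * x) = R ^ (n - 1) * poly Q x"
      using R by (auto simp: Q field_simps)
  qed
  then have G0: "G x 1 = 0" for x using Q[of x] by simp
  have "poly (right_poly n \<xi>) y = 0" if y: "of_int b * y \<noteq> r - of_int a" for y
  proof -
    \<comment> \<open>The parameter \<open>x\<close> is found by requiring (1,y) to be proportional
      to the point with eigencoordinates (x,1). This fails only when (1,y) lies on the eigenline of
      \<open>(b, r - a)\<close>, that is, for a single y. The factor \<open>u\<close> is nonzero
      because \<open>r \<noteq> s\<close>.\<close>
    define z where "z = of_int b * y - (r - of_int a)"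
    define x where "x = (s - of_int a - of_int b * y) / z"
    have z: "z \<noteq> 0" using y by (simp add: z_def)
    define u where "u = of_int b * (x + 1)"
    have "x + 1 = (s - r) / z" using z by (simp add: x_def z_def field_simps)
    then have u: "u \<noteq> 0" using b z \<open>r \<noteq> s\<close> by (simp add: u_def)
    have xz: "x * z = s - of_int a - of_int b * y" using z by (simp add: x_def)
    have "(r - of_int a) * x + (s - of_int a) * 1 = u * y"
      using xz by (simp add: z_def u_def algebra_simps)
    then have "binary_form n \<xi> (u * 1) (u * y) = 0" using G0[of x] by (simp add: G_def u_def)
    then have "binary_form n \<xi> 1 y = 0"
      using u n(2) binary_form_scale[of n \<xi> u 1 y] by simp
    then show ?thesis by (simp add: poly_right_poly)
  qed
  then have "UNIV - {(r - of_int a) / of_int b} \<subseteq> {y. poly (right_poly n \<xi>) y = 0}"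
    using b by (auto simp: field_simps)
  then have "infinite {y. poly (right_poly n \<xi>) y = 0}"
    using infinite_UNIV_char_0[where 'a = real] by (meson finite.emptyI finite_insert finite_subset Diff_infinite_finite)
  then have "right_poly n \<xi> = 0" using poly_roots_finite by blast
  then show ?thesis by (simp add: right_poly_eq_0_iff)
qed

lemma dual_orbit_hyperbolic_infinite:
  assumes "even n" "n \<ge> 2" "h \<in> SL2Z" "hyperbolic h" "\<exists>j<n. \<xi> j \<noteq> 0"
  shows "infinite ((\<lambda>g. dual n g \<xi>) ` cyclic_subgroup h)"
proof -
  have "inj (\<lambda>k. dual n (sl2_pow h k) \<xi>)"
    by (rule linorder_injI) (use dual_sl2_pow_eq_imp[OF assms(1-4)] assms(5) in blast)
  then have "infinite (range (\<lambda>k. dual n (sl2_pow h k) \<xi>))" by (rule range_inj_infinite)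
  moreover have "range (\<lambda>k. dual n (sl2_pow h k) \<xi>) \<subseteq> (\<lambda>g. dual n g \<xi>) ` cyclic_subgroup h"
    by (auto simp: cyclic_subgroup_def)
  ultimately show ?thesis using finite_subset by blast
qed

section \<open>Kernel of the representation, and conclusion\<close>

text \<open>Three corner entries of the matrix are c^(n-1), b^(n-1) and a^(n-1). They force a
  diagonal matrix with a = d = 1 or a = d = -1, the latter only for \<open>n - 1\<close>
  even.\<close>

lemma rho_eq_id_imp:
  assumes n: "n \<ge> 2" and g: "g \<in> SL2Z"
    and id: "\<And>i j. i < n \<Longrightarrow> j < n \<Longrightarrow> rho n g i j = (if i = j then 1 else 0)"
  shows "g = (1,0,0,1) \<or> (odd n \<and> g = (-1,0,0,-1))"
proof -
  obtain a b c d where g_eq: "g = (a,b,c,d)" by (metis prod_cases4)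
  have "c ^ (n - 1) = 0" "b ^ (n - 1) = 0" "a ^ (n - 1) = 1"
    using id[of "n - 1" 0] id[of 0 "n - 1"] id[of 0 0] n
    by (simp_all add: g_eq coeff_linear_poly_power)
  then have cb: "c = 0" "b = 0" and a: "a ^ (n - 1) = 1" by simp_all
  then have "a * d = 1" using g by (simp add: g_eq SL2Z_def)
  then consider "a = 1" "d = 1" | "a = -1" "d = -1" by (auto simp: zmult_eq_1_iff)
  then show ?thesis
  proof cases
    case 2
    then have "even (n - 1)" using a by (metis neg_one_odd_power one_neq_neg_one)
    then show ?thesis using 2 cb n by (simp add: g_eq)
  qed (simp add: g_eq cb)
qed

theorem theorem1p1:
  fixes n :: nat
  assumes "n \<ge> 2"
  shows "(ergodic_on n SL2Z \<and> essentially_free n) \<and>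
         (even n \<longrightarrow> (\<forall>h\<in>SL2Z. hyperbolic h \<longrightarrow> ergodic_on n (cyclic_subgroup h)))"
proof -
  \<comment> \<open>SL_2(Z) is countable, so the null sets of its elements can be treated one at a
    time; elements acting as the identity matrix are covered by
    \<open>rho_eq_id_imp\<close>.\<close>
  have free: "essentially_free n"
    unfolding essentially_free_def
  proof (subst AE_ball_countable, rule countable_subset[OF subset_UNIV countableI_type], rule ballI)
    fix g assume g: "g \<in> SL2Z"
    show "AE x in torus n. act n g x = x \<longrightarrow> g = (1,0,0,1) \<or> (odd n \<and> g = (-1,0,0,-1))"
    proof (cases "\<exists>i<n. \<exists>j<n. rho n g i j \<noteq> (if i = j then 1 else 0)")
      case True
      then obtain i j where "i < n" "j < n" "rho n g i j \<noteq> (if i = j then 1 else 0)" by blast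
      from AE_not_fixed[OF this] show ?thesis by eventually_elim simp
    next
      case False
      then have "g = (1,0,0,1) \<or> (odd n \<and> g = (-1,0,0,-1))"
        by (intro rho_eq_id_imp[OF assms g]) blast
      then show ?thesis by simp
    qed
  qed
  have ergodic: "ergodic_on n SL2Z"
    by (rule ergodic_on_if_dual_orbits_infinite[OF subset_refl dual_orbit_SL2Z_infinite[OF assms]])
  have "ergodic_on n (cyclic_subgroup h)" if "even n" "h \<in> SL2Z" "hyperbolic h" for h
    using that assms
    by (intro ergodic_on_if_dual_orbits_infinite cyclic_subgroup_subset_SL2Z
        dual_orbit_hyperbolic_infinite)
  then show ?thesis using free ergodic by blast
qed

end
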